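(* In the multidimensional Siegmund problem described in the context, assume the coordinates $X_{1,1},\ldots,X_{1,d}$ of $X_1$ are independent and identically distributed. If $d\ge1+\ell/u$, then $r_*=\min_{k\in[d]}r_{\{k\}}$. Further, if $d\ge2+2\ell/u$, then $\mathbb{P}_{\Theta^{(0)}}$ is asymptotically efficient for estimating $\mathbb{P}(\tau_b^*<\tau_b^\emptyset)$, where $\Theta^{(0)}=\{\beta^{\{k\}}:k\in[d]\}$.
   Context: $X_1,X_2,\ldots$ are i.i.d. $\mathbb{R}^d$-valued random vectors on $(\Omega,\mathcal{F},\mathbb{P})$ with $\mathbb{E}[X_{1,k}]<0$ for each coordinate $k\in[d]=\{1,\dots,d\}$; $S_0=0$, $S_n=\sum_{i\le n}X_i$, $\mathcal{F}_n=\sigma(X_1,\ldots,X_n)$. $\Lambda(\theta)=\log\mathbb{E}[e^{\theta\cdot X_1}]$, $\Lambda^*(x)=\sup_\theta\{\theta\cdot x-\Lambda(\theta)\}$, $I(x)=\sup\{\theta\cdot x:\Lambda(\theta)\le0\}$; $\operatorname{dom}(f)=\{f<\infty\}$, $\operatorname{cone}(A)=\{\lambda x:\lambda>0,x\in A\}$. Multidimensional Siegmund problem: fix $\ell,u>0$. For $A\subset[d]$, $$W^A=\{x\in\mathbb{R}^d:x_k>u\text{ for }k\in A,\ x_{k'}<-\ell\text{ for }k'\notin A\},$$ $\tau_b^A=\inf\{n\ge0:S_n\in bW^A\}$ ($b>0$, $\inf\emptyset=\infty$), and $\tau_b^*=\min\{\tau_b^A:\emptyset\ne A\subset[d]\}$.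 Standing assumption: $\operatorname{dom}(\Lambda)$ is open and $\operatorname{int}(\operatorname{cone}(\operatorname{dom}(\Lambda^* )))\cap W^A\neq\emptyset$ for every nonempty $A\subset[d]$. For nonempty $A$: $r_A=\inf_{x\in W^A}I(x)$, $r_*=\min_{\emptyset\ne A\subset[d]}r_A$, and $\beta^A$ is the unique vector with $\Lambda(\beta^A)=0$, $W^A\subset\{v:\beta^A\cdot v\ge r_A\}$, $\{x:I(x)\le r_A\}\subset\{v:\beta^A\cdot v\le r_A\}$ (existence and uniqueness are known). For $\theta\in\operatorname{dom}(\Lambda)$, $\mathbb{P}_\theta$ is the probability measure with $\frac{d\mathbb{P}_\theta}{d\mathbb{P}}(\mathcal{F}_n)=\exp(\theta\cdot S_n-n\Lambda(\theta))$ for all $n$. For finite nonempty $\Theta\subset\operatorname{dom}(\Lambda)$, $\mathbb{P}_\Theta=\frac1{|\Theta|}\sum_{\theta\in\Theta}\mathbb{P}_\theta$ (expectation $\mathbb{E}_\Theta$) and $$\widehat{\mathbb{W}}_b(\Theta)=\Big(\frac1{|\Theta|}\sum_{\theta\in\Theta}\exp(\theta\cdot S_{\tau_b^*}-\tau_b^*\Lambda(\theta))\Big)^{-1}\mathbf 1\{\tau_b^*<\tau_b^\emptyset\}.$$ $\mathbb{P}_\Theta$ is asymptotically efficient for estimating $\mathbb{P}(\tau_b^*<\tau_b^\emptyset)$ if $\log\mathbb{E}_\Theta[(\widehat{\mathbb{W}}_b(\Theta))^2]\big/\big(2\log\mathbb{P}(\tau_b^*<\tau_b^\emptyset)\big)\to1$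 as $b\to\infty$. *)

theory Defs
  imports "HOL-Probability.Probability"
begin

definition ln_ennreal :: "ennreal \<Rightarrow> ereal" where
  "ln_ennreal x =
     (if x = 0 then - \<infinity> else if x = \<infinity> then \<infinity> else ereal (ln (enn2real x)))"

definition log_mgf :: "'w measure \<Rightarrow> ('w \<Rightarrow> real ^ 'd) \<Rightarrow> real ^ 'd \<Rightarrow> ereal" where
  "log_mgf M Y \<theta> = ln_ennreal (\<integral>\<^sup>+ \<omega>. ennreal (exp (\<theta> \<bullet> Y \<omega>)) \<partial>M)"

definition edom :: "('a \<Rightarrow> ereal) \<Rightarrow> 'a set" where
  "edom f = {x. f x < \<infinity>}"

text \<open>The library's cone hull allows the factor zero, so it differs from this set at the origin.\<close>

definition pos_cone :: "'a::real_vector set \<Rightarrow> 'a set" where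
  "pos_cone A = {c *\<^sub>R x | c x. c > 0 \<and> x \<in> A}"

definition conjugate :: "(real ^ 'd \<Rightarrow> ereal) \<Rightarrow> real ^ 'd \<Rightarrow> ereal" where
  "conjugate \<Lambda> x = (SUP \<theta>. ereal (\<theta> \<bullet> x) - \<Lambda> \<theta>)"

definition rate :: "(real ^ 'd \<Rightarrow> ereal) \<Rightarrow> real ^ 'd \<Rightarrow> ereal" where
  "rate \<Lambda> x = (SUP \<theta>\<in>{\<theta>. \<Lambda> \<theta> \<le> 0}. ereal (\<theta> \<bullet> x))"

definition W :: "real \<Rightarrow> real \<Rightarrow> 'd set \<Rightarrow> (real ^ 'd) set" where
  "W l u A = {x. (\<forall>k\<in>A. x $ k > u) \<and> (\<forall>k. k \<notin> A \<longrightarrow> x $ k < - l)}"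

definition r :: "(real ^ 'd \<Rightarrow> ereal) \<Rightarrow> real \<Rightarrow> real \<Rightarrow> 'd set \<Rightarrow> ereal" where
  "r \<Lambda> l u A = (INF x\<in>W l u A. rate \<Lambda> x)"

definition r_star :: "(real ^ 'd \<Rightarrow> ereal) \<Rightarrow> real \<Rightarrow> real \<Rightarrow> ereal" where
  "r_star \<Lambda> l u = (MIN A\<in>{A. A \<noteq> {}}. r \<Lambda> l u A)"

definition beta :: "(real ^ 'd \<Rightarrow> ereal) \<Rightarrow> real \<Rightarrow> real \<Rightarrow> 'd set \<Rightarrow> real ^ 'd" where
  "beta \<Lambda> l u A = (THE \<beta>. \<Lambda> \<beta> = 0
      \<and> W l u A \<subseteq> {v. r \<Lambda> l u A \<le> ereal (\<beta> \<bullet> v)}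
      \<and> {x. rate \<Lambda> x \<le> r \<Lambda> l u A} \<subseteq> {v. ereal (\<beta> \<bullet> v) \<le> r \<Lambda> l u A})"

text \<open>The increments are indexed from 1; the value of the process at index 0 is not used.\<close>

definition S :: "(nat \<Rightarrow> 'w \<Rightarrow> real ^ 'd) \<Rightarrow> nat \<Rightarrow> 'w \<Rightarrow> real ^ 'd" where
  "S X n \<omega> = (\<Sum>i\<in>{1..n}. X i \<omega>)"

definition hist :: "'w measure \<Rightarrow> (nat \<Rightarrow> 'w \<Rightarrow> real ^ 'd) \<Rightarrow> nat \<Rightarrow> 'w measure" where
  "hist M X n =
     sigma (space M) (\<Union>i\<in>{1..n}. {X i -` B \<inter> space M | B. B \<in> sets borel})"

definition tau ::
    "(nat \<Rightarrow> 'w \<Rightarrow> real ^ 'd) \<Rightarrow> real \<Rightarrow> real \<Rightarrow> real \<Rightarrow> 'd set \<Rightarrow> 'w \<Rightarrow> enat" where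
  "tau X l u b A \<omega> = Inf {enat n | n. S X n \<omega> \<in> (\<lambda>x. b *\<^sub>R x) ` W l u A}"

definition tau_star ::
    "(nat \<Rightarrow> 'w \<Rightarrow> real ^ 'd) \<Rightarrow> real \<Rightarrow> real \<Rightarrow> real \<Rightarrow> 'w \<Rightarrow> enat" where
  "tau_star X l u b \<omega> = (MIN A\<in>{A. A \<noteq> {}}. tau X l u b A \<omega>)"

definition rare_event ::
    "'w measure \<Rightarrow> (nat \<Rightarrow> 'w \<Rightarrow> real ^ 'd) \<Rightarrow> real \<Rightarrow> real \<Rightarrow> real \<Rightarrow> 'w set" where
  "rare_event M X l u b = {\<omega> \<in> space M. tau_star X l u b \<omega> < tau X l u b {} \<omega>}"

text \<open>
  A measure with these densities need not exist on an arbitrary sample space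
  (it does on the canonical sequence space), so this is a predicate and not a construction.
\<close>

definition exp_tilt ::
    "'w measure \<Rightarrow> (nat \<Rightarrow> 'w \<Rightarrow> real ^ 'd) \<Rightarrow> (real ^ 'd \<Rightarrow> ereal) \<Rightarrow> real ^ 'd \<Rightarrow> 'w measure \<Rightarrow> bool"
where
  "exp_tilt M X \<Lambda> \<theta> Q \<longleftrightarrow> prob_space Q \<and> sets Q = sets M \<and>
     (\<forall>n. restr_to_subalg Q (hist M X n) =
        density (restr_to_subalg M (hist M X n))
          (\<lambda>\<omega>. ennreal (exp (\<theta> \<bullet> S X n \<omega> - real n * real_of_ereal (\<Lambda> \<theta>)))))"

definition mixture ::
    "'w measure \<Rightarrow> (real ^ 'd \<Rightarrow> 'w measure) \<Rightarrow> (real ^ 'd) set \<Rightarrow> 'w measure" where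
  "mixture M P \<Theta> = measure_of (space M) (sets M)
     (\<lambda>E. (\<Sum>\<theta>\<in>\<Theta>. emeasure (P \<theta>) E) / of_nat (card \<Theta>))"

text \<open>On the rare event the stopping time is finite, so \<open>the_enat\<close> is applied to a finite value there.\<close>

definition estimator ::
    "'w measure \<Rightarrow> (nat \<Rightarrow> 'w \<Rightarrow> real ^ 'd) \<Rightarrow> (real ^ 'd \<Rightarrow> ereal) \<Rightarrow> real \<Rightarrow> real \<Rightarrow>
     (real ^ 'd) set \<Rightarrow> real \<Rightarrow> 'w \<Rightarrow> real" where
  "estimator M X \<Lambda> l u \<Theta> b \<omega> =
     (let T = the_enat (tau_star X l u b \<omega>) in
       inverse ((\<Sum>\<theta>\<in>\<Theta>. exp (\<theta> \<bullet> S X T \<omega> - real T * real_of_ereal (\<Lambda> \<theta>))) / real (card \<Theta>))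
       * indicator (rare_event M X l u b) \<omega>)"

text \<open>
  An infinite second moment or a null rare event makes the quotient 0 (division by an infinite
  \<open>ereal\<close> gives 0) or infinite, so convergence to 1 excludes both for large \<open>b\<close>.
\<close>

definition asymp_efficient ::
    "'w measure \<Rightarrow> (nat \<Rightarrow> 'w \<Rightarrow> real ^ 'd) \<Rightarrow> (real ^ 'd \<Rightarrow> ereal) \<Rightarrow> real \<Rightarrow> real \<Rightarrow>
     (real ^ 'd \<Rightarrow> 'w measure) \<Rightarrow> (real ^ 'd) set \<Rightarrow> bool" where
  "asymp_efficient M X \<Lambda> l u P \<Theta> \<longleftrightarrow>
     ((\<lambda>b. ln_ennreal (\<integral>\<^sup>+ \<omega>. ennreal ((estimator M X \<Lambda> l u \<Theta> b \<omega>)\<^sup>2) \<partial>mixture M P \<Theta>)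
           / (2 * ln_ennreal (emeasure M (rare_event M X l u b)))) \<longlongrightarrow> 1) at_top"

end

theory Submission
  imports Defs "HOL-Real_Asymp.Real_Asymp"
begin

text \<open>
  By independence \<open>\<Lambda> \<theta> = (\<Sum>k. f (\<theta> $ k))\<close> with a convex cumulant generating function \<open>f\<close>. A pair
  \<open>s > 0\<close>, \<open>t \<ge> 0\<close> with \<open>f s + (d - 1) f (- t) = 0\<close> is chosen so that the gradient of \<open>\<Lambda>\<close> at
  the vector with entry \<open>s\<close> at \<open>k\<close> and \<open>- t\<close> elsewhere is a multiple of a point \<open>xbar k\<close> in the
  closure of \<open>W\<close> for \<open>{k}\<close>, with entries \<open>u\<close> and \<open>- L\<close>, where \<open>L = l\<close> unless \<open>t = 0\<close>.
  Convexity then makes this vector \<open>\<beta>\<close> and identifies \<open>r\<close>, without a minimax theorem.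
  Jensen's inequality gives \<open>s \<ge> (d - 1) t\<close>. Hence the vector \<open>\<theta>\<^sub>A\<close> with entries \<open>s\<close> on \<open>A\<close> and
  \<open>- t\<close> off \<open>A\<close> satisfies \<open>\<Lambda> \<theta>\<^sub>A \<le> 0\<close> and \<open>\<theta>\<^sub>A \<bullet> x \<ge> r\<close> on \<open>W A\<close> as soon as \<open>d - 1 \<ge> l / u\<close>.

  The second moment of the estimator is \<open>E[Z; R]\<close>, with \<open>Z\<close> the inverse likelihood ratio at the
  exit time. If \<open>d \<ge> 2 + 2 l / u\<close>, every \<open>x\<close> in \<open>W A\<close> satisfies
  \<open>\<beta> \<bullet> x + \<theta>\<^sub>A \<bullet> x \<ge> 2 r\<close> for the \<open>\<beta>\<close> that belongs to the largest coordinate of \<open>x\<close>: one \<open>r\<close> is gained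
  from the weight and, after a change of measure to \<open>\<theta>\<^sub>A\<close>, the other from the probability of exit
  through \<open>W A\<close>. Thus the second moment is at most \<open>C exp (- 2 r b)\<close>. It is at least \<open>P(R)\<^sup>2\<close>, and
  Cramer's tilting argument bounds \<open>P(R)\<close> below by \<open>exp (- r b (1 + o(1)))\<close>.
\<close>

section \<open>Convex profiles\<close>

text \<open>What is kept of the cumulant generating function of one coordinate. Compact sublevel
  sets let the optimisation below attain its maximum inside the open set \<open>D\<close>; strict
  midpoint convexity serves the uniqueness of \<open>beta\<close>.\<close>

locale cgf_profile =
  fixes D :: "real set" and f f' :: "real \<Rightarrow> real"
  assumes open_D: "open D"
    and convex_f: "convex_on D f"
    and zero_D: "0 \<in> D"
    and f_0: "f 0 = 0"
    and DERIV_f: "x \<in> D \<Longrightarrow> (f has_real_derivative f' x) (at x)"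
    and f'_0: "f' 0 < 0"
    and compact_sublevel: "compact {x \<in> D. f x \<le> c}"
    and f_midpoint: "x \<in> D \<Longrightarrow> y \<in> D \<Longrightarrow> x \<noteq> y \<Longrightarrow> f ((x + y) / 2) < (f x + f y) / 2"
begin

lemma continuous_f: "continuous_on D f"
  using DERIV_f by (meson DERIV_isCont continuous_at_imp_continuous_on)

lemma tangent:
  assumes "x \<in> D" "y \<in> D"
  shows "f x + f' x * (y - x) \<le> f y"
proof -
  have "f y - f x \<ge> f' x * (y - x)"
  proof (rule convex_on_imp_above_tangent[OF convex_f])
    show "connected D" using convex_f convex_connected convex_on_imp_convex by blast
    show "x \<in> interior D" using assms open_D interior_open by blast
    show "(f has_real_derivative f' x) (at x within D)"
      using DERIV_f[OF assms(1)] has_field_derivative_at_within by blast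
  qed (fact assms)
  then show ?thesis by simp
qed

lemma f_ge: "x \<in> D \<Longrightarrow> f' 0 * x \<le> f x"
  using tangent[OF zero_D, of x] f_0 by simp

text \<open>The tangent inequalities at \<open>0\<close> and at \<open>x\<close> add up to
  monotonicity of the slope, so \<open>f' x\<close> is at most \<open>f' 0\<close> for negative
  \<open>x\<close>.\<close>

lemma f'_neg: "x \<in> D \<Longrightarrow> x \<le> 0 \<Longrightarrow> f' x < 0"
proof (cases "x = 0")
  case False
  assume x: "x \<in> D" "x \<le> 0"
  have "f x + f' x * (0 - x) \<le> 0" using tangent[OF x(1) zero_D] f_0 by simp
  with f_ge[OF x(1)] have "(f' x - f' 0) * (- x) \<le> 0" by (simp add: algebra_simps)
  then have "f' x \<le> f' 0" using x(2) False by (simp add: zero_le_mult_iff)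
  then show ?thesis using f'_0 by simp
qed (use f'_0 in simp)

lemma eventually_line_D: "x \<in> D \<Longrightarrow> \<forall>\<^sub>F h in at_right 0. x + h * v \<in> D"
proof -
  assume x: "x \<in> D"
  have "((\<lambda>h. x + h * v) \<longlongrightarrow> x + 0 * v) (at_right 0)"
    by (intro tendsto_intros)
  with open_D x show ?thesis by (auto dest!: topological_tendstoD)
qed

text \<open>A direction with negative first derivative stays in the open domain and lowers the
  weighted sum for all small steps. This drives the stationarity argument in
  \<open>optimal_pair\<close>.\<close>

lemma descent:
  assumes x: "x \<in> D" and y: "y \<in> D" and v: "f' x * v + c * f' y * w < 0"
  shows "\<forall>\<^sub>F h in at_right 0. x + h * v \<in> D \<and> y + h * w \<in> D
           \<and> f (x + h * v) + c * f (y + h * w) < f x + c * f y"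
proof -
  let ?g = "\<lambda>h. f (x + h * v) + c * f (y + h * w)"
  have 1: "(f has_real_derivative f' x) (at (x + 0 * v))" using DERIV_f[OF x] by simp
  have 2: "(f has_real_derivative f' y) (at (y + 0 * w))" using DERIV_f[OF y] by simp
  have g1: "((\<lambda>h. f (x + h * v)) has_real_derivative f' x * v) (at 0)"
    by (rule DERIV_chain2[where f = f and g = "\<lambda>h. x + h * v", OF 1]) (auto intro!: derivative_eq_intros)
  have g2: "((\<lambda>h. f (y + h * w)) has_real_derivative f' y * w) (at 0)"
    by (rule DERIV_chain2[where f = f and g = "\<lambda>h. y + h * w", OF 2]) (auto intro!: derivative_eq_intros)
  have "(?g has_real_derivative f' x * v + c * f' y * w) (at 0)"
    using DERIV_add[OF g1 DERIV_cmult[OF g2, of c]] by (simp add: mult.assoc)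
  from DERIV_neg_dec_right[OF this v] obtain d where d: "d > 0"
    "\<And>h. h > 0 \<Longrightarrow> h < d \<Longrightarrow> ?g h < ?g 0" by auto
  then have "\<forall>\<^sub>F h in at_right 0. ?g h < ?g 0"
    by (auto simp: eventually_at_right_field)
  with eventually_line_D[OF x, of v] eventually_line_D[OF y, of w] show ?thesis
    by eventually_elim simp
qed

text \<open>The root is the largest point of the zero sublevel set. It is positive because
  \<open>f\<close> is negative just to the right of \<open>0\<close>, and \<open>f\<close> vanishes
  there because otherwise continuity would allow a larger point. The tangent at \<open>z\<close>,
  compared with a point where \<open>f h < 0\<close>, gives the positive slope.\<close>

lemma positive_root: "\<exists>z>0. z \<in> D \<and> f z = 0 \<and> 0 < f' z"
proof -
  let ?K = "{x \<in> D. f x \<le> 0}"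
  have "?K \<noteq> {}" using zero_D f_0 by auto
  from compact_attains_sup[OF compact_sublevel this]
  obtain z where z: "z \<in> D" "f z \<le> 0" "\<And>x. x \<in> D \<Longrightarrow> f x \<le> 0 \<Longrightarrow> x \<le> z" by auto
  have "\<forall>\<^sub>F h in at_right 0. 0 + h * 1 \<in> D \<and> f (0 + h * 1) < 0"
    using descent[OF zero_D zero_D, of 1 0 0] f'_0 f_0 by (auto elim: eventually_mono)
  moreover have "\<forall>\<^sub>F h in at_right (0::real). h > 0" by (simp add: eventually_at_right_less)
  ultimately have "\<forall>\<^sub>F h in at_right 0. h > 0 \<and> h \<in> D \<and> f h < 0"
    by eventually_elim simp
  then obtain h where h: "h > 0" "h \<in> D" "f h < 0"
    by (metis (no_types, lifting) eventually_happens trivial_limit_at_right_real)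
  have hz: "h \<le> z" using z(3) h by simp
  have "f z = 0"
  proof (rule ccontr)
    assume "f z \<noteq> 0"
    then have lt: "f z < 0" using z by simp
    have "isCont f z" using DERIV_f[OF z(1)] DERIV_isCont by blast
    moreover have "((\<lambda>h. z + h * 1) \<longlongrightarrow> z + 0 * 1) (at_right 0)"
      by (intro tendsto_intros)
    ultimately have "((\<lambda>h. f (z + h * 1)) \<longlongrightarrow> f z) (at_right 0)"
      using isCont_tendsto_compose[where g = f] by force
    then have "\<forall>\<^sub>F h in at_right 0. f (z + h * 1) < 0" using lt order_tendstoD(2) by blast
    moreover note eventually_line_D[OF z(1), of 1]
    moreover have "\<forall>\<^sub>F h in at_right (0::real). h > 0" by (simp add: eventually_at_right_less)
    ultimately have "\<forall>\<^sub>F h in at_right (0::real). False"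
    proof eventually_elim
      case (elim h)
      then show ?case using z(3)[of "z + h * 1"] by simp
    qed
    then show False by simp
  qed
  moreover have "f' z > 0"
  proof -
    have "f' z * (h - z) < 0" using tangent[OF z(1) h(2)] \<open>f z = 0\<close> h(3) by simp
    then show ?thesis using hz by (simp add: mult_less_0_iff)
  qed
  ultimately show ?thesis using z(1) h hz by (intro exI[of _ z]) auto
qed

text \<open>A global lower bound of \<open>f\<close> turns the bound on the weighted sum into an
  upper bound for each summand, so the set is a closed part of a product of compact sublevel
  sets.\<close>

lemma compact_level:
  assumes c: "c > 0"
  shows "compact {p \<in> D \<times> D. f (fst p) + c * f (snd p) \<le> 0}"
proof -
  let ?K = "{x \<in> D. f x \<le> 0}"
  obtain m where m: "\<And>x. x \<in> D \<Longrightarrow> m \<le> f x"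
  proof -
    have "?K \<noteq> {}" using zero_D f_0 by auto
    from continuous_attains_inf[OF compact_sublevel this]
    obtain z where "z \<in> D" "f z \<le> 0" "\<And>x. x \<in> D \<Longrightarrow> f x \<le> 0 \<Longrightarrow> f z \<le> f x"
      using continuous_f continuous_on_subset by (metis (no_types, lifting) mem_Collect_eq subsetI)
    then show ?thesis using that[of "f z"] by (metis linear order_trans)
  qed
  define B where "B = max (- c * m) (- m / c)"
  let ?L = "{x \<in> D. f x \<le> B}"
  have sub: "{p \<in> D \<times> D. f (fst p) + c * f (snd p) \<le> 0}
      = {p \<in> ?L \<times> ?L. f (fst p) + c * f (snd p) \<le> 0}"
  proof (safe; simp)
    fix x y assume xy: "x \<in> D" "y \<in> D" "f x + c * f y \<le> 0"
    have "c * m \<le> c * f y" using m[OF xy(2)] c by simp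
    then have "f x \<le> - c * m" using xy(3) by linarith
    then show "f x \<le> B" by (simp add: B_def)
    have "c * f y \<le> - m" using m[OF xy(1)] xy(3) by linarith
    then have "f y \<le> - m / c" using c by (simp add: field_simps)
    then show "f y \<le> B" by (simp add: B_def)
  qed
  have cont: "continuous_on (?L \<times> ?L) (\<lambda>p. f (fst p) + c * f (snd p))"
    by (intro continuous_intros continuous_on_compose2[OF continuous_f]) auto
  have K: "compact (?L \<times> ?L)" by (intro compact_Times compact_sublevel)
  have cl: "closed ((?L \<times> ?L) \<inter> (\<lambda>p. f (fst p) + c * f (snd p)) -` {..0})" (is "closed ?C")
    by (rule continuous_closed_preimage[OF cont compact_imp_closed[OF K]]) simp
  have "{p \<in> ?L \<times> ?L. f (fst p) + c * f (snd p) \<le> 0} = (?L \<times> ?L) \<inter> ?C" by auto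
  then show ?thesis unfolding sub by (simp only: compact_Int_closed[OF K cl])
qed

text \<open>Apart from a boundary case, \<open>(s, - t)\<close> maximises
  \<open>u * x - l * c * y\<close> over \<open>f x + c * f y \<le> 0\<close>. The equations for
  \<open>f'\<close> are the Lagrange conditions with multiplier \<open>1 / \<kappa>\<close>; the
  weight \<open>c\<close> stands for the number of coordinates that share the entry
  \<open>- t\<close>.\<close>

lemma optimal_pair:
  fixes u l c :: real
  assumes u: "u > 0" and l: "l > 0" and c: "c > 0"
  obtains s t L \<kappa> where "s > 0" "t \<ge> 0" "s \<in> D" "- t \<in> D" "L \<ge> l" "L = l \<or> t = 0" "\<kappa> > 0"
    "f s + c * f (- t) = 0" "f' s = \<kappa> * u" "f' (- t) = - \<kappa> * L" "c * t \<le> s"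
proof -
  obtain z where z: "z > 0" "z \<in> D" "f z = 0" "0 < f' z" using positive_root by auto
  show ?thesis
  \<comment> \<open>The cases compare slopes at \<open>(z, 0)\<close>. In the first one, raising the
    second entry from \<open>0\<close> along the constraint does not lower the objective to first
    order. Then \<open>t = 0\<close> is taken, and \<open>L\<close> is chosen so that the slopes at
    \<open>z\<close> and \<open>0\<close> are proportional to \<open>u\<close> and
    \<open>- L\<close>.\<close>
  proof (cases "f' z * l \<le> u * - f' 0")
    case True
    show ?thesis
    proof (rule that[of z 0 "- f' 0 * u / f' z" "f' z / u"])
      show "- f' 0 * u / f' z \<ge> l" using True z(4) by (simp add: field_simps)
    qed (use z zero_D f_0 u in \<open>auto simp: field_simps\<close>)
  next
    case False
    let ?C = "{p \<in> D \<times> D. f (fst p) + c * f (snd p) \<le> 0}"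
    have zC: "(z, 0) \<in> ?C" using z zero_D f_0 by simp
    have "continuous_on ?C (\<lambda>p. u * fst p - l * c * snd p)" by (intro continuous_intros)
    from continuous_attains_sup[OF compact_level[OF c] _ this] zC
    obtain p where p: "p \<in> ?C"
      "\<And>q. q \<in> ?C \<Longrightarrow> u * fst q - l * c * snd q \<le> u * fst p - l * c * snd p" by blast
    define x y where "x = fst p" and "y = snd p"
    have xy: "x \<in> D" "y \<in> D" "f x + c * f y \<le> 0" using p(1) by (auto simp: x_def y_def)
    have opt: "u * x' - l * c * y' \<le> u * x - l * c * y"
      if "x' \<in> D" "y' \<in> D" "f x' + c * f y' \<le> 0" for x' y'
      using p(2)[of "(x', y')"] that by (simp add: x_def y_def)
    \<comment> \<open>The tangents at \<open>z\<close> and at \<open>0\<close> show that, in this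
      case, a feasible pair with positive second entry is strictly worse than the feasible pair
      \<open>(z, 0)\<close>.\<close>
    have y: "y \<le> 0"
    proof (rule ccontr)
      assume "\<not> y \<le> 0"
      then have y0: "0 < y" by simp
      have "f' z * (x - z) + c * (f' 0 * y) \<le> 0"
        using tangent[OF z(2) xy(1)] f_ge[OF xy(2)] mult_left_mono[of "f' 0 * y" "f y" c] c xy(3) z(3)
        by linarith
      then have "u * (f' z * (x - z) + c * (f' 0 * y)) \<le> 0" using u by (simp add: mult_le_0_iff)
      moreover have "c * y * (u * - f' 0) < c * y * (f' z * l)"
        using False c y0 by (intro mult_strict_left_mono) auto
      ultimately have "f' z * (u * x - l * c * y) < f' z * (u * z)"
        by (simp add: algebra_simps)
      then have "u * x - l * c * y < u * z" using z(4) by simp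
      with opt[OF z(2) zero_D] z(3) f_0 show False by simp
    qed
    have stationary: "u * v - l * c * w \<le> 0" if vw: "f' x * v + c * f' y * w < 0" for v w
    proof -
      have "\<forall>\<^sub>F h in at_right (0::real). h > 0" by (simp add: eventually_at_right_less)
      with descent[OF xy(1,2) vw] have "\<forall>\<^sub>F h in at_right (0::real). u * v - l * c * w \<le> 0"
      proof eventually_elim
        case (elim h)
        then have "u * (x + h * v) - l * c * (y + h * w) \<le> u * x - l * c * y"
          using opt xy(3) by simp
        then have "h * (u * v - l * c * w) \<le> 0" by (simp add: algebra_simps)
        then show ?case using elim by (simp add: mult_le_0_iff)
      qed
      then show ?thesis by simp
    qed
    \<comment> \<open>Up to sign, \<open>e\<close> is the determinant of \<open>(f' x, f' y)\<close>
      and \<open>(u, - l)\<close>; it vanishes exactly when the two are parallel.\<close>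
    define e where "e = f' x * l + f' y * u"
    have "e = 0"
    proof (rule ccontr)
      assume e: "e \<noteq> 0"
      define g where "g = f' x * u - f' y * l"
      define \<delta> where "\<delta> = \<bar>e\<bar> / (1 + \<bar>g\<bar>)"
      have \<delta>: "\<delta> > 0" "\<delta> * g < \<bar>e\<bar>"
      proof -
        show "\<delta> > 0" using e by (simp add: \<delta>_def)
        have "\<delta> * g \<le> \<delta> * \<bar>g\<bar>" using \<open>\<delta> > 0\<close> by (intro mult_left_mono) auto
        also have "\<dots> < \<delta> * (1 + \<bar>g\<bar>)" using \<open>\<delta> > 0\<close> by simp
        also have "\<dots> = \<bar>e\<bar>" by (simp add: \<delta>_def)
        finally show "\<delta> * g < \<bar>e\<bar>" .
      qed
      \<comment> \<open>The vector \<open>(v, c * w)\<close> is \<open>\<delta>\<close> times the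
        ascent direction \<open>(u, - l)\<close> plus an orthogonal part of sign
        \<open>- sgn e\<close>. The first part improves the objective; the second lowers the
        constraint by \<open>\<bar>e\<bar>\<close>, which outweighs \<open>\<delta> * g\<close> by
        the choice of \<open>\<delta>\<close>.\<close>
      define v w where "v = \<delta> * u - sgn e * l" and "w = (- \<delta> * l - sgn e * u) / c"
      have cw: "c * w = - \<delta> * l - sgn e * u" using c by (simp add: w_def)
      have "f' x * v + c * f' y * w = f' x * v + f' y * (c * w)" by simp
      also have "\<dots> = \<delta> * g - sgn e * e"
        unfolding cw v_def g_def by (subst (3) e_def) (simp add: algebra_simps)
      also have "\<dots> < 0" using \<delta>(2) by (simp add: mult.commute[of "sgn e"] mult_sgn_abs abs_sgn)
      finally have "u * v - l * c * w \<le> 0" by (rule stationary)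
      moreover have "u * v - l * (c * w) = \<delta> * (u * u + l * l)"
        unfolding cw v_def by (simp add: algebra_simps)
      moreover have "\<dots> > 0" using \<delta>(1) u l by (intro mult_pos_pos add_pos_pos)
      ultimately show False by (simp add: mult.assoc)
    qed
    have fy: "f' y < 0" using f'_neg[OF xy(2) y] .
    have fx: "f' x * l = - f' y * u" using \<open>e = 0\<close> by (simp add: e_def)
    then have "f' x * l > 0" using fy u by (simp add: mult_neg_pos)
    then have fx0: "f' x > 0" using l by (simp add: zero_less_mult_iff)
    \<comment> \<open>With a slack constraint, \<open>x\<close> could be increased a little, which
      improves the objective.\<close>
    have eq0: "f x + c * f y = 0"
    proof (rule ccontr)
      assume "f x + c * f y \<noteq> 0"
      then have lt: "f x + c * f y < 0" using xy(3) by simp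
      have "isCont f x" using DERIV_f[OF xy(1)] DERIV_isCont by blast
      moreover have "((\<lambda>h. x + h * 1) \<longlongrightarrow> x + 0 * 1) (at_right 0)"
        by (intro tendsto_intros)
      ultimately have "((\<lambda>h. f (x + h * 1)) \<longlongrightarrow> f x) (at_right 0)"
        using isCont_tendsto_compose[where g = f] by force
      then have "((\<lambda>h. f (x + h * 1) + c * f y) \<longlongrightarrow> f x + c * f y) (at_right 0)"
        by (intro tendsto_intros)
      then have "\<forall>\<^sub>F h in at_right 0. f (x + h * 1) + c * f y < 0"
        using lt order_tendstoD(2) by blast
      moreover note eventually_line_D[OF xy(1), of 1]
      moreover have "\<forall>\<^sub>F h in at_right (0::real). h > 0" by (simp add: eventually_at_right_less)
      ultimately have "\<forall>\<^sub>F h in at_right (0::real). False"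
      proof eventually_elim
        case (elim h)
        then have "u * (x + h * 1) - l * c * y \<le> u * x - l * c * y" using opt[OF _ xy(2)] by simp
        then have "u * h \<le> 0" by (simp add: algebra_simps)
        then show ?case using u elim by (simp add: mult_le_0_iff)
      qed
      then show False by simp
    qed
    \<comment> \<open>Jensen in the form of the tangent at \<open>0\<close>; since
      \<open>f' 0 < 0\<close>, it yields \<open>c * t \<le> s\<close>.\<close>
    have "f' 0 * x + c * (f' 0 * y) \<le> 0"
      using f_ge[OF xy(1)] mult_left_mono[OF f_ge[OF xy(2)], of c] c eq0 by linarith
    then have "f' 0 * (x + c * y) \<le> 0" by (simp add: algebra_simps)
    then have xcy: "x + c * y \<ge> 0" using f'_0 by (simp add: mult_le_0_iff)
    have x: "x > 0"
    proof (rule ccontr)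
      assume "\<not> x > 0"
      then have "f' x < 0" using f'_neg[OF xy(1)] by simp
      with fx0 show False by simp
    qed
    show ?thesis
    proof (rule that[of x "- y" l "f' x / u"])
      show "f' (- (- y)) = - (f' x / u) * l" using fx u by (simp add: field_simps)
    qed (use x y xy eq0 xcy fx0 u in auto)
  qed
qed

end

section \<open>Cumulant generating functions\<close>

definition mgf_dom :: "'a measure \<Rightarrow> ('a \<Rightarrow> real) \<Rightarrow> real set" where
  "mgf_dom M Y = {t. integrable M (\<lambda>\<omega>. exp (t * Y \<omega>))}"

text \<open>Real-valued, so it carries meaning on \<open>mgf_dom M Y\<close> only: elsewhere the
  integral has its default value \<open>0\<close>.\<close>

definition cgf :: "'a measure \<Rightarrow> ('a \<Rightarrow> real) \<Rightarrow> real \<Rightarrow> real" where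
  "cgf M Y t = ln (\<integral>\<omega>. exp (t * Y \<omega>) \<partial>M)"

text \<open>The mean of \<open>Y\<close> under the exponential tilt by \<open>t\<close>.\<close>

definition cgf' :: "'a measure \<Rightarrow> ('a \<Rightarrow> real) \<Rightarrow> real \<Rightarrow> real" where
  "cgf' M Y t = (\<integral>\<omega>. Y \<omega> * exp (t * Y \<omega>) \<partial>M) / (\<integral>\<omega>. exp (t * Y \<omega>) \<partial>M)"

lemma exp_convex_combination:
  fixes p q w :: real
  assumes "0 \<le> w" "w \<le> 1"
  shows "exp ((1 - w) * p + w * q) \<le> (1 - w) * exp p + w * exp q"
  using convex_onD[OF exp_convex assms, of p q] by simp

lemma exp_midpoint_less:
  fixes p q :: real
  assumes "p \<noteq> q"
  shows "exp ((p + q) / 2) < (exp p + exp q) / 2"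
proof -
  have "0 < (exp (p / 2) - exp (q / 2))\<^sup>2" using assms by simp
  also have "\<dots> = exp p + exp q - 2 * exp ((p + q) / 2)"
    by (simp add: power2_eq_square algebra_simps add_divide_distrib flip: exp_add)
  finally show ?thesis by simp
qed

text \<open>Provides the dominating function in \<open>mgf_DERIV\<close>. The quotient is at most
  \<open>\<bar>y\<bar> * exp (\<delta> * \<bar>y\<bar>)\<close>, and the linear factor is absorbed
  by doubling the exponent.\<close>

lemma exp_quotient_bound:
  fixes y h \<delta> :: real
  assumes \<delta>: "\<delta> > 0" and h: "\<bar>h\<bar> \<le> \<delta>" "h \<noteq> 0"
  shows "\<bar>(exp (h * y) - 1) / h\<bar> \<le> (exp (2 * \<delta> * y) + exp (- (2 * \<delta> * y))) / \<delta>"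
proof -
  have le: "\<bar>exp z - 1\<bar> \<le> \<bar>z\<bar> * exp \<bar>z\<bar>" for z :: real
  proof (cases "z \<ge> 0")
    case True
    have "exp (- z) \<ge> 1 - z" using exp_ge_add_one_self[of "- z"] by simp
    then have "exp z * (1 - z) \<le> exp z * exp (- z)" by (intro mult_left_mono) auto
    then show ?thesis using True by (simp add: algebra_simps flip: exp_add)
  next
    case False
    then have "1 - exp z \<le> - z" using exp_ge_add_one_self[of z] by linarith
    also have "- z \<le> - z * exp (- z)" using False by simp
    finally show ?thesis using False by simp
  qed
  have "\<bar>(exp (h * y) - 1) / h\<bar> \<le> (\<bar>h * y\<bar> * exp \<bar>h * y\<bar>) / \<bar>h\<bar>"
    unfolding abs_divide by (intro divide_right_mono le) simp
  also have "\<dots> = \<bar>y\<bar> * exp (\<bar>h\<bar> * \<bar>y\<bar>)" using h by (simp add: abs_mult)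
  also have "\<dots> \<le> \<bar>y\<bar> * exp (\<delta> * \<bar>y\<bar>)" using h by (intro mult_left_mono) (auto intro: mult_right_mono)
  also have "\<dots> = (\<delta> * \<bar>y\<bar>) * exp (\<delta> * \<bar>y\<bar>) / \<delta>" using \<delta> by simp
  also have "\<dots> \<le> exp (\<delta> * \<bar>y\<bar>) * exp (\<delta> * \<bar>y\<bar>) / \<delta>"
  proof -
    have "\<delta> * \<bar>y\<bar> \<le> exp (\<delta> * \<bar>y\<bar>)" using exp_ge_add_one_self[of "\<delta> * \<bar>y\<bar>"] by linarith
    then show ?thesis using \<delta> by (intro divide_right_mono mult_right_mono) auto
  qed
  also have "\<dots> = exp (2 * \<delta> * \<bar>y\<bar>) / \<delta>" by (simp flip: exp_add)
  also have "\<dots> \<le> (exp (2 * \<delta> * y) + exp (- (2 * \<delta> * y))) / \<delta>"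
    using \<delta> by (intro divide_right_mono) (auto simp: abs_if)
  finally show ?thesis .
qed

text \<open>The negative mean bounds the sublevel sets on the left and \<open>not_AE_le_0\<close>
  bounds them on the right; together they also exclude a constant \<open>Y\<close>, which makes the
  convexity strict.\<close>

locale negative_mean_rv = prob_space M for M :: "'a measure" +
  fixes Y :: "'a \<Rightarrow> real"
  assumes integrable_Y: "integrable M Y"
    and mean_neg: "expectation Y < 0"
    and not_AE_le_0: "\<not> (AE \<omega> in M. Y \<omega> \<le> 0)"
    and open_dom: "open (mgf_dom M Y)"
begin

lemma Y_measurable [measurable]: "Y \<in> borel_measurable M"
  using integrable_Y by simp

lemma mgf_pos: "t \<in> mgf_dom M Y \<Longrightarrow> 0 < (\<integral>\<omega>. exp (t * Y \<omega>) \<partial>M)"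
  using integral_less_AE_space[of "\<lambda>_. 0" "\<lambda>\<omega>. exp (t * Y \<omega>)"]
  by (simp add: mgf_dom_def emeasure_space_1)

lemma normalised:
  assumes "t \<in> mgf_dom M Y"
  shows "integrable M (\<lambda>\<omega>. exp (t * Y \<omega> - cgf M Y t))" "(\<integral>\<omega>. exp (t * Y \<omega> - cgf M Y t) \<partial>M) = 1"
  using assms mgf_pos[OF assms] by (simp_all add: exp_diff cgf_def mgf_dom_def)

lemma zero_in_dom: "0 \<in> mgf_dom M Y"
  by (simp add: mgf_dom_def)

text \<open>Subtracting \<open>cgf\<close> in the exponents gives both exponentials integral
  \<open>1\<close>; integrating the pointwise convexity of \<open>exp\<close> then plays the role of
  Hoelder's inequality.\<close>

lemma
  assumes x: "x \<in> mgf_dom M Y" and y: "y \<in> mgf_dom M Y" and w: "0 \<le> w" "w \<le> 1"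
  shows dom_combination: "(1 - w) * x + w * y \<in> mgf_dom M Y"
    and cgf_combination: "cgf M Y ((1 - w) * x + w * y) \<le> (1 - w) * cgf M Y x + w * cgf M Y y"
proof -
  let ?z = "(1 - w) * x + w * y" and ?c = "(1 - w) * cgf M Y x + w * cgf M Y y"
  let ?p = "\<lambda>\<omega>. x * Y \<omega> - cgf M Y x" and ?q = "\<lambda>\<omega>. y * Y \<omega> - cgf M Y y"
  have pw: "exp (?z * Y \<omega> - ?c) \<le> (1 - w) * exp (?p \<omega>) + w * exp (?q \<omega>)" for \<omega>
    using exp_convex_combination[OF w, of "?p \<omega>" "?q \<omega>"] by (simp add: algebra_simps)
  have int: "integrable M (\<lambda>\<omega>. (1 - w) * exp (?p \<omega>) + w * exp (?q \<omega>))"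
    using normalised(1)[OF x] normalised(1)[OF y] by simp
  have int_z: "integrable M (\<lambda>\<omega>. exp (?z * Y \<omega> - ?c))"
    by (rule Bochner_Integration.integrable_bound[OF int]) (use pw w in \<open>auto intro!: AE_I2\<close>)
  then have "integrable M (\<lambda>\<omega>. exp ?c * exp (?z * Y \<omega> - ?c))" by simp
  then show z: "?z \<in> mgf_dom M Y" by (simp add: mgf_dom_def exp_diff)
  have "(\<integral>\<omega>. exp (?z * Y \<omega> - ?c) \<partial>M) \<le> (\<integral>\<omega>. (1 - w) * exp (?p \<omega>) + w * exp (?q \<omega>) \<partial>M)"
    by (rule integral_mono[OF int_z int]) (rule pw)
  also have "\<dots> = 1" using normalised[OF x] normalised[OF y] by simp
  finally have "(\<integral>\<omega>. exp (?z * Y \<omega>) \<partial>M) \<le> exp ?c" by (simp add: exp_diff)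
  with mgf_pos[OF z] have "cgf M Y ?z \<le> ln (exp ?c)"
    unfolding cgf_def[of M Y ?z] by (simp only: ln_le_cancel_iff exp_gt_zero)
  then show "cgf M Y ?z \<le> ?c" by simp
qed

lemma cgf_convex: "convex_on (mgf_dom M Y) (cgf M Y)"
  using dom_combination cgf_combination
  by (intro convex_onI) (auto simp: convex_alt)

text \<open>As for convexity, but with the strict midpoint inequality. Equality almost everywhere
  would force \<open>Y\<close> to be a constant, which is negative like its mean and contradicts
  \<open>not_AE_le_0\<close>.\<close>

lemma cgf_midpoint:
  assumes x: "x \<in> mgf_dom M Y" and y: "y \<in> mgf_dom M Y" and ne: "x \<noteq> y"
  shows "cgf M Y ((x + y) / 2) < (cgf M Y x + cgf M Y y) / 2"
proof -
  let ?z = "(x + y) / 2" and ?c = "(cgf M Y x + cgf M Y y) / 2"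
  let ?p = "\<lambda>\<omega>. x * Y \<omega> - cgf M Y x" and ?q = "\<lambda>\<omega>. y * Y \<omega> - cgf M Y y"
  have z: "?z \<in> mgf_dom M Y"
    using dom_combination[OF x y, of "1 / 2"] by (simp add: add_divide_distrib)
  have eq: "?z * Y \<omega> - ?c = (?p \<omega> + ?q \<omega>) / 2" for \<omega> by (simp add: field_simps)
  let ?A = "{\<omega> \<in> space M. ?p \<omega> \<noteq> ?q \<omega>}"
  have A: "emeasure M ?A \<noteq> 0"
  proof
    assume "emeasure M ?A = 0"
    then have "AE \<omega> in M. ?p \<omega> = ?q \<omega>" by (subst AE_iff_measurable[OF _ refl]) auto
    then have AE: "AE \<omega> in M. Y \<omega> = (cgf M Y x - cgf M Y y) / (x - y)" (is "AE \<omega> in M. Y \<omega> = ?k")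
      by eventually_elim (use ne in \<open>simp add: field_simps\<close>)
    then have "expectation Y = expectation (\<lambda>_. ?k)" by (intro integral_cong_AE) auto
    then have "?k < 0" using mean_neg prob_space by simp
    from AE have "AE \<omega> in M. Y \<omega> \<le> 0" by eventually_elim (use \<open>?k < 0\<close> in simp)
    with not_AE_le_0 show False by simp
  qed
  have int: "integrable M (\<lambda>\<omega>. (exp (?p \<omega>) + exp (?q \<omega>)) / 2)"
    using normalised(1)[OF x] normalised(1)[OF y] by simp
  have int_z: "integrable M (\<lambda>\<omega>. exp (?z * Y \<omega> - ?c))"
    using z by (simp add: mgf_dom_def exp_diff)
  have "(\<integral>\<omega>. exp (?z * Y \<omega> - ?c) \<partial>M) < (\<integral>\<omega>. (exp (?p \<omega>) + exp (?q \<omega>)) / 2 \<partial>M)"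
  proof (rule integral_less_AE[OF int_z int A])
    show "AE \<omega> in M. \<omega> \<in> ?A \<longrightarrow> exp (?z * Y \<omega> - ?c) \<noteq> (exp (?p \<omega>) + exp (?q \<omega>)) / 2"
    proof (intro AE_I2 impI)
      fix \<omega> assume "\<omega> \<in> ?A"
      then show "exp (?z * Y \<omega> - ?c) \<noteq> (exp (?p \<omega>) + exp (?q \<omega>)) / 2"
        unfolding eq using exp_midpoint_less[of "?p \<omega>" "?q \<omega>"] by simp
    qed
    show "AE \<omega> in M. exp (?z * Y \<omega> - ?c) \<le> (exp (?p \<omega>) + exp (?q \<omega>)) / 2"
    proof (intro AE_I2)
      fix \<omega>
      show "exp (?z * Y \<omega> - ?c) \<le> (exp (?p \<omega>) + exp (?q \<omega>)) / 2"
        unfolding eq using exp_midpoint_less[of "?p \<omega>" "?q \<omega>"] by (cases "?p \<omega> = ?q \<omega>") auto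
    qed
  qed measurable
  also have "\<dots> = 1" using normalised[OF x] normalised[OF y] by simp
  finally have "(\<integral>\<omega>. exp (?z * Y \<omega>) \<partial>M) < exp ?c" by (simp add: exp_diff)
  with mgf_pos[OF z] have "cgf M Y ?z < ln (exp ?c)"
    unfolding cgf_def[of M Y ?z] by (simp only: ln_less_cancel_iff exp_gt_zero)
  then show ?thesis by simp
qed

lemma cgf_ge_mean: "t \<in> mgf_dom M Y \<Longrightarrow> expectation Y * t \<le> cgf M Y t"
proof -
  assume t: "t \<in> mgf_dom M Y"
  let ?e = "\<lambda>\<omega>. t * Y \<omega> - cgf M Y t"
  have "(\<integral>\<omega>. 1 + ?e \<omega> \<partial>M) \<le> (\<integral>\<omega>. exp (?e \<omega>) \<partial>M)"
    by (rule integral_mono[OF _ normalised(1)[OF t]]) (auto simp: integrable_Y exp_ge_add_one_self)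
  then have "1 + (t * expectation Y - cgf M Y t) \<le> 1"
    using normalised(2)[OF t] integrable_Y prob_space by simp
  then show ?thesis by (simp add: mult.commute)
qed

text \<open>From below, \<open>expectation Y * t \<le> cgf M Y t\<close> with a negative mean. From
  above, \<open>t * m\<close> is at most the generating function, where \<open>m\<close> is the
  positive mean of the positive part of \<open>Y\<close>.\<close>

lemma bounded_sublevel: "bounded {t \<in> mgf_dom M Y. cgf M Y t \<le> c}"
proof -
  define m where "m = expectation (\<lambda>\<omega>. max (Y \<omega>) 0)"
  have int: "integrable M (\<lambda>\<omega>. max (Y \<omega>) 0)" using integrable_Y by simp
  have "m \<noteq> 0"
  proof
    assume "m = 0"
    then have "AE \<omega> in M. max (Y \<omega>) 0 = 0"
      unfolding m_def by (subst (asm) integral_nonneg_eq_0_iff_AE[OF int]) auto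
    then have "AE \<omega> in M. Y \<omega> \<le> 0" by eventually_elim (simp add: max_def split: if_splits)
    with not_AE_le_0 show False by simp
  qed
  moreover have "m \<ge> 0" unfolding m_def by (intro integral_nonneg_AE) auto
  ultimately have m: "m > 0" by simp
  have "t \<in> {min (c / expectation Y) 0 .. max (exp c / m) 0}" if t: "t \<in> mgf_dom M Y" "cgf M Y t \<le> c" for t
  proof -
    have "expectation Y * t \<le> c" using cgf_ge_mean[OF t(1)] t(2) by simp
    then have 1: "c / expectation Y \<le> t" using mean_neg by (simp add: divide_le_eq mult.commute)
    have 2: "t \<le> exp c / m" if "t \<ge> 0"
    proof -
      have "t * m = (\<integral>\<omega>. t * max (Y \<omega>) 0 \<partial>M)" by (simp add: m_def)
      also have "\<dots> \<le> (\<integral>\<omega>. exp (t * Y \<omega>) \<partial>M)"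
      proof (rule integral_mono)
        show "t * max (Y \<omega>) 0 \<le> exp (t * Y \<omega>)" for \<omega>
        proof (cases "Y \<omega> \<ge> 0")
          case True
          have "t * Y \<omega> \<le> exp (t * Y \<omega>)" using exp_ge_add_one_self[of "t * Y \<omega>"] by linarith
          then show ?thesis using True by (simp add: max_absorb1)
        qed (simp add: max_absorb2)
      qed (use int t(1) in \<open>auto simp: mgf_dom_def\<close>)
      also have "\<dots> = exp (cgf M Y t)" using mgf_pos[OF t(1)] by (simp add: cgf_def)
      also have "\<dots> \<le> exp c" using t(2) by simp
      finally show ?thesis using m by (simp add: field_simps)
    qed
    show ?thesis using 1 2 by (cases "t \<ge> 0") (auto simp: min_le_iff_disj le_max_iff_disj)
  qed
  then have "{t \<in> mgf_dom M Y. cgf M Y t \<le> c} \<subseteq> {min (c / expectation Y) 0 .. max (exp c / m) 0}"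
    by blast
  then show ?thesis using bounded_subset bounded_closed_interval by blast
qed

lemma mgf_nn_integral: "t \<in> mgf_dom M Y \<Longrightarrow> (\<integral>\<^sup>+\<omega>. ennreal (exp (t * Y \<omega>)) \<partial>M) = ennreal (exp (cgf M Y t))"
  using mgf_pos[of t] by (subst nn_integral_eq_integral) (auto simp: mgf_dom_def cgf_def)

lemma mgf_dom_iff: "t \<in> mgf_dom M Y \<longleftrightarrow> (\<integral>\<^sup>+\<omega>. ennreal (exp (t * Y \<omega>)) \<partial>M) < \<infinity>"
  by (simp add: mgf_dom_def integrable_iff_bounded)

lemma sublevel_iff:
  "t \<in> mgf_dom M Y \<and> cgf M Y t \<le> c \<longleftrightarrow> (\<integral>\<^sup>+\<omega>. ennreal (exp (t * Y \<omega>)) \<partial>M) \<le> ennreal (exp c)"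
proof (cases "t \<in> mgf_dom M Y")
  case False
  then show ?thesis by (auto simp: mgf_dom_iff intro: le_less_trans)
qed (simp add: mgf_nn_integral)

text \<open>Fatou's lemma. The form in \<open>sublevel_iff\<close> includes membership in the
  domain, so limits of points of a sublevel set remain in \<open>mgf_dom M Y\<close>.\<close>

lemma closed_sublevel: "closed {t \<in> mgf_dom M Y. cgf M Y t \<le> c}"
  unfolding closed_sequential_limits sublevel_iff mem_Collect_eq
proof (intro allI impI, elim conjE)
  fix x t assume x: "\<forall>n. (\<integral>\<^sup>+\<omega>. ennreal (exp (x n * Y \<omega>)) \<partial>M) \<le> ennreal (exp c)"
    and lim: "x \<longlonglongrightarrow> t"
  have "(\<integral>\<^sup>+\<omega>. ennreal (exp (t * Y \<omega>)) \<partial>M) = (\<integral>\<^sup>+\<omega>. liminf (\<lambda>n. ennreal (exp (x n * Y \<omega>))) \<partial>M)"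
  proof (intro nn_integral_cong)
    fix \<omega>
    have "(\<lambda>n. ennreal (exp (x n * Y \<omega>))) \<longlonglongrightarrow> ennreal (exp (t * Y \<omega>))"
      by (intro tendsto_intros lim)
    then show "ennreal (exp (t * Y \<omega>)) = liminf (\<lambda>n. ennreal (exp (x n * Y \<omega>)))"
      by (rule lim_imp_Liminf[OF trivial_limit_sequentially, symmetric])
  qed
  also have "\<dots> \<le> liminf (\<lambda>n. \<integral>\<^sup>+\<omega>. ennreal (exp (x n * Y \<omega>)) \<partial>M)"
    by (rule nn_integral_liminf) simp
  also have "\<dots> \<le> ennreal (exp c)"
    by (rule Liminf_le) (use x in \<open>auto simp: eventually_sequentially\<close>)
  finally show "(\<integral>\<^sup>+\<omega>. ennreal (exp (t * Y \<omega>)) \<partial>M) \<le> ennreal (exp c)" .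
qed

lemma mgf_DERIV:
  assumes t: "t \<in> mgf_dom M Y"
  shows "((\<lambda>t. \<integral>\<omega>. exp (t * Y \<omega>) \<partial>M) has_real_derivative (\<integral>\<omega>. Y \<omega> * exp (t * Y \<omega>) \<partial>M)) (at t)"
proof -
  obtain e where e: "e > 0" "cball t e \<subseteq> mgf_dom M Y"
    using open_dom t open_contains_cball by blast
  define \<delta> where "\<delta> = e / 2"
  have \<delta>: "\<delta> > 0" using e by (simp add: \<delta>_def)
  have in_dom: "t + h \<in> mgf_dom M Y" if "\<bar>h\<bar> \<le> 2 * \<delta>" for h
    using that e(2) by (auto simp: \<delta>_def dist_real_def subset_iff)
  \<comment> \<open>Integrable because \<open>t + 2 * \<delta>\<close> and
    \<open>t - 2 * \<delta>\<close> are both in the closed ball of radius \<open>e\<close>; this is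
    why \<open>\<delta>\<close> is half of \<open>e\<close>.\<close>
  define B where "B \<omega> = exp (t * Y \<omega>) * ((exp (2 * \<delta> * Y \<omega>) + exp (- (2 * \<delta> * Y \<omega>))) / \<delta>)" for \<omega>
  have "B = (\<lambda>\<omega>. (exp ((t + 2 * \<delta>) * Y \<omega>) + exp ((t + - (2 * \<delta>)) * Y \<omega>)) / \<delta>)"
    by (simp add: B_def fun_eq_iff algebra_simps add_divide_distrib flip: exp_add)
  then have B: "integrable M B"
    using in_dom[of "2 * \<delta>"] in_dom[of "- (2 * \<delta>)"] \<delta> by (simp add: mgf_dom_def)
  show ?thesis
    unfolding has_field_derivative_iff tendsto_at_iff_sequentially
  proof (intro allI impI)
    fix x assume x: "\<forall>i. x i \<in> UNIV - {t}" and lim: "x \<longlonglongrightarrow> t"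
    define h where "h i = x i - t" for i
    have h0: "h \<longlonglongrightarrow> 0" using tendsto_diff[OF lim tendsto_const[of t]] by (simp add: h_def[abs_def])
    have hne: "h i \<noteq> 0" for i using x by (simp add: h_def)
    have "\<forall>\<^sub>F i in sequentially. \<bar>h i\<bar> < \<delta>"
      using order_tendstoD(2)[OF tendsto_rabs_zero[OF h0] \<delta>] .
    then obtain N where N: "\<And>i. i \<ge> N \<Longrightarrow> \<bar>h i\<bar> < \<delta>" by (auto simp: eventually_sequentially)
    define g where "g i \<omega> = exp (t * Y \<omega>) * ((exp (h (i + N) * Y \<omega>) - 1) / h (i + N))" for i \<omega>
    have "(\<lambda>i. \<integral>\<omega>. g i \<omega> \<partial>M) \<longlonglongrightarrow> (\<integral>\<omega>. exp (t * Y \<omega>) * Y \<omega> \<partial>M)"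
    proof (rule integral_dominated_convergence[where w = B])
      show "AE \<omega> in M. (\<lambda>i. g i \<omega>) \<longlonglongrightarrow> exp (t * Y \<omega>) * Y \<omega>"
      proof (intro AE_I2)
        fix \<omega>
        have "((\<lambda>h. exp (h * Y \<omega>)) has_real_derivative Y \<omega>) (at 0)"
          by (auto intro!: derivative_eq_intros)
        then have "((\<lambda>h. (exp (h * Y \<omega>) - 1) / h) \<longlongrightarrow> Y \<omega>) (at 0)"
          by (simp add: has_field_derivative_iff)
        then have "(\<lambda>i. (exp (h (i + N) * Y \<omega>) - 1) / h (i + N)) \<longlonglongrightarrow> Y \<omega>"
          unfolding tendsto_at_iff_sequentially
          using hne LIMSEQ_ignore_initial_segment[OF h0, of N] by (auto simp: comp_def)
        then show "(\<lambda>i. g i \<omega>) \<longlonglongrightarrow> exp (t * Y \<omega>) * Y \<omega>"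
          unfolding g_def by (intro tendsto_intros)
      qed
      show "AE \<omega> in M. norm (g i \<omega>) \<le> B \<omega>" for i
      proof (intro AE_I2)
        fix \<omega>
        have "\<bar>h (i + N)\<bar> \<le> \<delta>" using N[of "i + N"] by simp
        from exp_quotient_bound[OF \<delta> this hne]
        show "norm (g i \<omega>) \<le> B \<omega>"
          unfolding g_def B_def real_norm_def abs_mult by (intro mult_mono) auto
      qed
    qed (use B in \<open>auto simp: g_def\<close>)
    moreover have "(\<integral>\<omega>. g i \<omega> \<partial>M)
        = ((\<integral>\<omega>. exp (x (i + N) * Y \<omega>) \<partial>M) - (\<integral>\<omega>. exp (t * Y \<omega>) \<partial>M)) / (x (i + N) - t)" for i
    proof -
      have "\<bar>h (i + N)\<bar> \<le> 2 * \<delta>" using N[of "i + N"] \<delta> by simp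
      from in_dom[OF this] have "x (i + N) \<in> mgf_dom M Y" by (simp add: h_def)
      moreover have "g i \<omega> = (exp (x (i + N) * Y \<omega>) - exp (t * Y \<omega>)) / (x (i + N) - t)" for \<omega>
      proof -
        have "x (i + N) = t + h (i + N)" by (simp add: h_def)
        then show ?thesis by (simp add: g_def algebra_simps exp_add)
      qed
      ultimately show ?thesis using t by (simp add: mgf_dom_def)
    qed
    ultimately have "(\<lambda>i. ((\<integral>\<omega>. exp (x (i + N) * Y \<omega>) \<partial>M) - (\<integral>\<omega>. exp (t * Y \<omega>) \<partial>M)) / (x (i + N) - t))
        \<longlonglongrightarrow> (\<integral>\<omega>. Y \<omega> * exp (t * Y \<omega>) \<partial>M)" by (simp add: mult.commute)
    then show "((\<lambda>y. ((\<integral>\<omega>. exp (y * Y \<omega>) \<partial>M) - (\<integral>\<omega>. exp (t * Y \<omega>) \<partial>M)) / (y - t)) \<circ> x)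
        \<longlonglongrightarrow> (\<integral>\<omega>. Y \<omega> * exp (t * Y \<omega>) \<partial>M)"
      unfolding comp_def by (rule LIMSEQ_offset)
  qed
qed

sublocale cgf: cgf_profile "mgf_dom M Y" "cgf M Y" "cgf' M Y"
proof
  show "cgf M Y 0 = 0" by (simp add: cgf_def prob_space)
  show "cgf' M Y 0 < 0" using mean_neg by (simp add: cgf'_def prob_space)
  show "(cgf M Y has_real_derivative cgf' M Y x) (at x)" if "x \<in> mgf_dom M Y" for x
    using DERIV_chain2[OF DERIV_ln_divide mgf_DERIV[OF that], OF mgf_pos[OF that]]
    by (simp add: cgf_def[abs_def] cgf'_def)
  show "compact {x \<in> mgf_dom M Y. cgf M Y x \<le> c}" for c
    using bounded_sublevel closed_sublevel by (simp add: compact_eq_bounded_closed)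
qed (use open_dom cgf_convex zero_in_dom cgf_midpoint in auto)

end

section \<open>The optimal tilts\<close>

lemma sum_if_mem:
  fixes A :: "'d::finite set" and p q :: real
  shows "(\<Sum>j\<in>UNIV. if j \<in> A then p else q) = card A * p + (CARD('d) - real (card A)) * q"
proof -
  have "card (- A) = CARD('d) - card A" by (simp add: Compl_eq_Diff_UNIV card_Diff_subset)
  then have "real (card (- A)) = CARD('d) - real (card A)" by (simp add: of_nat_diff card_mono)
  then show ?thesis by (simp add: sum.If_cases)
qed

lemma W_inner_bounds:
  fixes A :: "'d::finite set" and x :: "real ^ 'd" and l u s t :: real
  assumes x: "x \<in> W l u A" and s: "s \<ge> 0" and t: "t \<ge> 0"
  shows "card A * (u * s) + (CARD('d) - real (card A)) * (l * t) \<le> (\<chi> j. if j \<in> A then s else - t) \<bullet> x"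
proof -
  have "(\<Sum>j\<in>UNIV. if j \<in> A then u * s else l * t) \<le> (\<Sum>j\<in>UNIV. (if j \<in> A then s else - t) * x $ j)"
  proof (rule sum_mono)
    fix j
    show "(if j \<in> A then u * s else l * t) \<le> (if j \<in> A then s else - t) * x $ j"
      using x s t mult_left_mono[of u "x $ j" s] mult_left_mono[of l "- x $ j" t]
      by (auto simp: W_def mult.commute less_imp_le)
  qed
  then show ?thesis by (simp add: sum_if_mem inner_vec_def)
qed

text \<open>The parameters \<open>s\<close>, \<open>t\<close>, \<open>L\<close>,
  \<open>\<kappa>\<close> are those delivered by \<open>optimal_pair\<close> with \<open>c\<close>
  equal to the number of coordinates minus one.\<close>

locale siegmund_tilt = cgf_profile D f f'
  for D :: "real set" and f f' :: "real \<Rightarrow> real" +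
  fixes \<Lambda> :: "real ^ 'd \<Rightarrow> ereal" and u l s t L \<kappa> :: real
  assumes \<Lambda>_eq: "\<Lambda> \<theta> = (if \<forall>k. \<theta> $ k \<in> D then ereal (\<Sum>k\<in>UNIV. f (\<theta> $ k)) else \<infinity>)"
    and u_pos: "u > 0" and l_pos: "l > 0" and card_ge: "real CARD('d) \<ge> 1 + l / u"
    and s_pos: "s > 0" and t_nonneg: "t \<ge> 0" and s_D: "s \<in> D" and t_D: "- t \<in> D"
    and L_ge: "L \<ge> l" and L_or: "L = l \<or> t = 0" and \<kappa>_pos: "\<kappa> > 0"
    and level: "f s + (CARD('d) - 1) * f (- t) = 0"
    and f'_s: "f' s = \<kappa> * u" and f'_t: "f' (- t) = - \<kappa> * L"
    and s_ge: "(CARD('d) - 1) * t \<le> s"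
begin

definition tilt :: "'d set \<Rightarrow> real ^ 'd" where
  "tilt A = (\<chi> j. if j \<in> A then s else - t)"

text \<open>The depth is \<open>L\<close> and not \<open>l\<close>: when \<open>t = 0\<close>, the
  point of least rate in the closure of \<open>W l u {k}\<close> may lie strictly below
  \<open>- l\<close> in the other coordinates.\<close>

definition xbar :: "'d \<Rightarrow> real ^ 'd" where
  "xbar k = (\<chi> j. if j = k then u else - L)"

text \<open>Written with \<open>l\<close>, although \<open>xbar\<close> uses \<open>L\<close>: the
  products with \<open>t\<close> agree since \<open>L = l\<close> or \<open>t = 0\<close>.\<close>

definition rbar :: real where
  "rbar = u * s + (CARD('d) - 1) * (l * t)"

lemma card_real: "real (CARD('d) - 1) = real CARD('d) - 1"
  by (simp add: of_nat_diff Suc_leI)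

lemma rbar_pos: "rbar > 0"
  unfolding rbar_def using u_pos s_pos l_pos t_nonneg by (intro add_pos_nonneg) auto

text \<open>The dimension bound for the first claim enters here: \<open>s\<close> is at least
  \<open>t\<close> times the number of coordinates minus one, and that number is at least
  \<open>l / u\<close>.\<close>

lemma u_s_ge: "l * t \<le> u * s"
proof -
  have "l \<le> u * (CARD('d) - 1)" using card_ge u_pos by (simp add: card_real field_simps)
  then have "l * t \<le> u * (CARD('d) - 1) * t" using t_nonneg by (intro mult_right_mono)
  also have "\<dots> \<le> u * s" using s_ge u_pos by simp
  finally show ?thesis .
qed

lemma f_s_le: "f s \<le> 0" and f_t_ge: "f (- t) \<ge> 0"
proof -
  have "f' 0 * - t \<le> f (- t)" by (rule f_ge[OF t_D])
  moreover have "f' 0 * - t \<ge> 0" using f'_0 t_nonneg by (simp add: mult_nonpos_nonneg)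
  ultimately show 1: "f (- t) \<ge> 0" by linarith
  have "real (CARD('d) - 1) * f (- t) \<ge> 0" using 1 by simp
  then show "f s \<le> 0" using level by linarith
qed

lemma card_pos_real: "A \<noteq> {} \<Longrightarrow> 1 \<le> real (card (A :: 'd set))"
  by (simp add: Suc_leI card_gt_0_iff)

lemma \<Lambda>_tilt: "\<Lambda> (tilt A) = ereal (card A * f s + (CARD('d) - real (card A)) * f (- t))"
proof -
  have "(\<Sum>k\<in>UNIV. f (tilt A $ k)) = (\<Sum>k\<in>UNIV. if k \<in> A then f s else f (- t))"
    by (intro sum.cong) (auto simp: tilt_def)
  then show ?thesis using s_D t_D by (simp add: \<Lambda>_eq sum_if_mem) (auto simp: tilt_def)
qed

lemma \<Lambda>_tilt_singleton: "\<Lambda> (tilt {k}) = 0"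
  using level by (simp add: \<Lambda>_tilt card_real zero_ereal_def)

text \<open>Starting from a singleton, where the value is \<open>0\<close>, each further element of
  \<open>A\<close> adds \<open>f s - f (- t)\<close>, which is not positive.\<close>

lemma \<Lambda>_tilt_le:
  assumes "A \<noteq> {}"
  shows "\<Lambda> (tilt A) \<le> 0"
proof -
  have "(real (card A) - 1) * (f s - f (- t)) \<le> 0"
    using card_pos_real[OF assms] f_s_le f_t_ge by (intro mult_nonneg_nonpos) auto
  then have "card A * f s + (CARD('d) - real (card A)) * f (- t) \<le> 0"
    using level by (simp add: card_real algebra_simps)
  then show ?thesis by (simp add: \<Lambda>_tilt zero_ereal_def)
qed

lemma tilt_edom: "tilt A \<in> edom \<Lambda>"
  by (simp add: edom_def \<Lambda>_tilt)

lemma rbar_eq: "rbar = tilt {k} \<bullet> xbar k"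
proof -
  have "tilt {k} \<bullet> xbar k = (\<Sum>j\<in>UNIV. if j \<in> {k} then s * u else t * L)"
    unfolding inner_vec_def by (intro sum.cong) (auto simp: tilt_def xbar_def)
  also have "\<dots> = rbar" using L_or unfolding sum_if_mem rbar_def by (auto simp: card_real algebra_simps)
  finally show ?thesis by simp
qed

lemma gradient: "f' (tilt {k} $ j) = \<kappa> * xbar k $ j"
  using f'_s f'_t by (simp add: tilt_def xbar_def)

text \<open>\<^term>\<open>xbar k\<close> is a normal vector of the zero sublevel set of \<open>\<Lambda>\<close> at \<^term>\<open>tilt {k}\<close>.\<close>

lemma inner_xbar_le:
  assumes "\<Lambda> \<theta> \<le> 0"
  shows "\<theta> \<bullet> xbar k \<le> rbar"
proof -
  have \<theta>: "\<And>j. \<theta> $ j \<in> D" "(\<Sum>j\<in>UNIV. f (\<theta> $ j)) \<le> 0"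
    using assms by (auto simp: \<Lambda>_eq zero_ereal_def split: if_splits)
  have "(\<Sum>j\<in>UNIV. f (tilt {k} $ j) + \<kappa> * xbar k $ j * (\<theta> $ j - tilt {k} $ j)) \<le> (\<Sum>j\<in>UNIV. f (\<theta> $ j))"
  proof (rule sum_mono)
    fix j
    have "tilt {k} $ j \<in> D" using s_D t_D by (simp add: tilt_def)
    from tangent[OF this \<theta>(1)[of j]]
    show "f (tilt {k} $ j) + \<kappa> * xbar k $ j * (\<theta> $ j - tilt {k} $ j) \<le> f (\<theta> $ j)"
      by (simp add: gradient)
  qed
  also have "(\<Sum>j\<in>UNIV. f (tilt {k} $ j) + \<kappa> * xbar k $ j * (\<theta> $ j - tilt {k} $ j))
      = (\<Sum>j\<in>UNIV. f (tilt {k} $ j)) + \<kappa> * (\<theta> \<bullet> xbar k - tilt {k} \<bullet> xbar k)"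
    by (simp add: sum.distrib inner_vec_def algebra_simps sum_subtractf sum_distrib_left)
  also have "(\<Sum>j\<in>UNIV. f (tilt {k} $ j)) = 0"
    using \<Lambda>_tilt_singleton[of k] by (auto simp: \<Lambda>_eq zero_ereal_def split: if_splits)
  finally have "\<kappa> * (\<theta> \<bullet> xbar k - rbar) \<le> 0" using \<theta>(2) by (simp add: rbar_eq[of k])
  then show ?thesis using \<kappa>_pos by (simp add: mult_le_0_iff)
qed

text \<open>The point \<open>xbar k\<close> itself is on the boundary of the open set
  \<open>W l u {k}\<close>; any dilation by more than \<open>1\<close> moves it inside.\<close>

lemma scaled_xbar_W: "c > 1 \<Longrightarrow> c *\<^sub>R xbar k \<in> W l u {k}"
proof -
  assume c: "c > 1"
  have "l < c * L"
  proof -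
    have "l * 1 < l * c" using c l_pos by simp
    also have "\<dots> \<le> c * L" using L_ge c by simp
    finally show ?thesis by simp
  qed
  then show ?thesis using c u_pos by (simp add: W_def xbar_def)
qed

lemma tilt_rate: "A \<noteq> {} \<Longrightarrow> ereal (tilt A \<bullet> x) \<le> rate \<Lambda> x"
  unfolding rate_def using \<Lambda>_tilt_le by (intro SUP_upper) simp

lemma tilt_W:
  "x \<in> W l u A \<Longrightarrow> card A * (u * s) + (CARD('d) - real (card A)) * (l * t) \<le> tilt A \<bullet> x"
  unfolding tilt_def by (rule W_inner_bounds[OF _ less_imp_le[OF s_pos] t_nonneg])

text \<open>Each element of \<open>A\<close> beyond the first exchanges a term \<open>l * t\<close>
  of the lower bound in \<open>tilt_W\<close> for the larger \<open>u * s\<close>.\<close>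

lemma tilt_W_ge:
  assumes "A \<noteq> {}" "x \<in> W l u A"
  shows "rbar \<le> tilt A \<bullet> x"
proof -
  have "(real (card A) - 1) * (u * s - l * t) \<ge> 0"
    using card_pos_real[OF assms(1)] u_s_ge by simp
  then have "rbar \<le> card A * (u * s) + (CARD('d) - real (card A)) * (l * t)"
    by (simp add: rbar_def card_real algebra_simps)
  also have "\<dots> \<le> tilt A \<bullet> x" by (rule tilt_W[OF assms(2)])
  finally show ?thesis .
qed

lemma r_ge: "A \<noteq> {} \<Longrightarrow> ereal rbar \<le> r \<Lambda> l u A"
  unfolding r_def by (intro INF_greatest order_trans[OF _ tilt_rate]) (simp_all add: tilt_W_ge)

text \<open>The dilated points \<open>c *\<^sub>R xbar k\<close> are in the set and have rate at
  most \<open>c * rbar\<close> by \<open>inner_xbar_le\<close>; the factor \<open>c\<close> is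
  chosen so that \<open>c * rbar\<close> exceeds \<open>rbar\<close> by \<open>e\<close>.\<close>

lemma r_singleton: "r \<Lambda> l u {k} = ereal rbar"
proof (rule antisym)
  show "r \<Lambda> l u {k} \<le> ereal rbar"
  proof (rule ereal_le_epsilon2)
    fix e :: real assume e: "e > 0"
    define c where "c = 1 + e / rbar"
    have c: "c > 1" using e rbar_pos by (simp add: c_def)
    have "rate \<Lambda> (c *\<^sub>R xbar k) \<le> ereal (c * rbar)"
      unfolding rate_def
      by (intro SUP_least) (use inner_xbar_le[of _ k] c in \<open>auto intro!: mult_left_mono\<close>)
    then have "r \<Lambda> l u {k} \<le> ereal (c * rbar)"
      unfolding r_def using scaled_xbar_W[OF c, of k] by (meson INF_lower order_trans)
    also have "c * rbar = rbar + e" using rbar_pos by (simp add: c_def field_simps)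
    finally show "r \<Lambda> l u {k} \<le> ereal rbar + ereal e" by simp
  qed
qed (rule r_ge, simp)

lemma r_star_eq: "r_star \<Lambda> l u = (MIN k. r \<Lambda> l u {k})"
proof -
  have "r_star \<Lambda> l u = ereal rbar"
    unfolding r_star_def
    by (rule Min_eqI) (use r_ge r_singleton in \<open>auto intro!: image_eqI[of _ _ "{undefined}"]\<close>)
  then show ?thesis by (simp add: r_singleton)
qed

text \<open>If \<open>\<beta>\<close> differed from \<open>tilt {k}\<close>, strict convexity would
  make \<open>\<Lambda>\<close> negative at their midpoint \<open>m\<close>, while still
  \<open>m \<bullet> xbar k \<ge> rbar\<close>. Raising coordinate \<open>k\<close> of
  \<open>m\<close> slightly keeps \<open>\<Lambda>\<close> at most \<open>0\<close> and contradicts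
  \<open>inner_xbar_le\<close>.\<close>

lemma beta_unique:
  assumes \<beta>: "\<Lambda> \<beta> = 0" and W: "W l u {k} \<subseteq> {v. r \<Lambda> l u {k} \<le> ereal (\<beta> \<bullet> v)}"
  shows "\<beta> = tilt {k}"
proof (rule ccontr)
  assume ne: "\<beta> \<noteq> tilt {k}"
  then obtain i where i: "\<beta> $ i \<noteq> tilt {k} $ i" by (auto simp: vec_eq_iff)
  have \<beta>D: "\<And>j. \<beta> $ j \<in> D" "(\<Sum>j\<in>UNIV. f (\<beta> $ j)) = 0"
    using \<beta> by (auto simp: \<Lambda>_eq zero_ereal_def split: if_splits)
  have TD: "\<And>j. tilt {k} $ j \<in> D" "(\<Sum>j\<in>UNIV. f (tilt {k} $ j)) = 0"
    using \<Lambda>_tilt_singleton[of k] by (auto simp: \<Lambda>_eq zero_ereal_def split: if_splits)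
  \<comment> \<open>Since \<open>xbar k\<close> is only a limit of points of
    \<open>W l u {k}\<close>, the inequality is obtained along dilations with factor tending to
    \<open>1\<close>.\<close>
  have \<beta>_ge: "rbar \<le> \<beta> \<bullet> xbar k"
  proof (rule tendsto_lowerbound)
    show "((\<lambda>c. c * (\<beta> \<bullet> xbar k)) \<longlongrightarrow> \<beta> \<bullet> xbar k) (at_right 1)"
      by (rule tendsto_eq_intros refl)+ simp
    have "rbar \<le> c * (\<beta> \<bullet> xbar k)" if "c > 1" for c
      using W scaled_xbar_W[OF that, of k] by (auto simp: r_singleton)
    then show "\<forall>\<^sub>F c in at_right 1. rbar \<le> c * (\<beta> \<bullet> xbar k)"
      by (auto simp: eventually_at_right_field intro: exI[of _ 2])
  qed simp
  define m where "m = (1 / 2) *\<^sub>R (\<beta> + tilt {k})"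
  have m: "m $ j = (\<beta> $ j + tilt {k} $ j) / 2" for j by (simp add: m_def)
  have mD: "m $ j \<in> D" for j
    using convexD[OF convex_on_imp_convex[OF convex_f] \<beta>D(1)[of j] TD(1)[of j], of "1/2" "1/2"]
    by (simp add: m add_divide_distrib)
  have "(\<Sum>j\<in>UNIV. f (m $ j)) < (\<Sum>j\<in>UNIV. (f (\<beta> $ j) + f (tilt {k} $ j)) / 2)"
  proof (rule sum_strict_mono_ex1)
    show "\<forall>j\<in>UNIV. f (m $ j) \<le> (f (\<beta> $ j) + f (tilt {k} $ j)) / 2"
    proof
      fix j
      show "f (m $ j) \<le> (f (\<beta> $ j) + f (tilt {k} $ j)) / 2"
        using f_midpoint[OF \<beta>D(1)[of j] TD(1)[of j]] by (cases "\<beta> $ j = tilt {k} $ j") (auto simp: m)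
    qed
    show "\<exists>j\<in>UNIV. f (m $ j) < (f (\<beta> $ j) + f (tilt {k} $ j)) / 2"
      using f_midpoint[OF \<beta>D(1)[of i] TD(1)[of i] i] by (auto simp: m)
  qed simp
  also have "\<dots> = 0" using \<beta>D(2) TD(2) by (simp add: sum.distrib flip: sum_divide_distrib)
  finally have neg: "(\<Sum>j\<in>UNIV. f (m $ j)) < 0" .
  define y where "y h = m + h *\<^sub>R axis k 1" for h
  have "((\<lambda>h. \<Sum>j\<in>UNIV. f (y h $ j)) \<longlongrightarrow> (\<Sum>j\<in>UNIV. f (m $ j))) (at_right 0)"
  proof (rule tendsto_sum)
    fix j
    have "isCont f (m $ j)" using DERIV_f[OF mD[of j]] DERIV_isCont by blast
    moreover have "((\<lambda>h. y h $ j) \<longlongrightarrow> m $ j) (at_right 0)"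
      unfolding y_def by (rule tendsto_eq_intros refl)+ simp
    ultimately show "((\<lambda>h. f (y h $ j)) \<longlongrightarrow> f (m $ j)) (at_right 0)"
      by (rule isCont_tendsto_compose)
  qed
  from order_tendstoD(2)[OF this neg]
  have "\<forall>\<^sub>F h in at_right 0. (\<Sum>j\<in>UNIV. f (y h $ j)) < 0" .
  moreover have "\<forall>\<^sub>F h in at_right 0. m $ k + h * 1 \<in> D" by (rule eventually_line_D[OF mD])
  moreover have "\<forall>\<^sub>F h in at_right (0::real). h > 0" by (simp add: eventually_at_right_less)
  ultimately have "\<forall>\<^sub>F h in at_right (0::real). False"
  proof eventually_elim
    case (elim h)
    have "\<forall>j. y h $ j \<in> D" using elim(2) mD by (auto simp: y_def axis_def)
    then have "\<Lambda> (y h) \<le> 0" using elim(1) by (simp add: \<Lambda>_eq zero_ereal_def)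
    from inner_xbar_le[OF this, of k]
    have "m \<bullet> xbar k + h * u \<le> rbar" by (simp add: y_def inner_add_left inner_axis' xbar_def)
    moreover have "m \<bullet> xbar k \<ge> rbar"
      using \<beta>_ge by (simp add: m_def inner_add_left rbar_eq[of k])
    ultimately have "h * u \<le> 0" by linarith
    then show False using elim(3) u_pos by (simp add: mult_le_0_iff)
  qed
  then show False by simp
qed

lemma beta_singleton: "beta \<Lambda> l u {k} = tilt {k}"
  unfolding beta_def
proof (rule the_equality)
  show "\<Lambda> (tilt {k}) = 0 \<and> W l u {k} \<subseteq> {v. r \<Lambda> l u {k} \<le> ereal (tilt {k} \<bullet> v)}
      \<and> {x. rate \<Lambda> x \<le> r \<Lambda> l u {k}} \<subseteq> {v. ereal (tilt {k} \<bullet> v) \<le> r \<Lambda> l u {k}}"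
  proof (intro conjI subsetI CollectI)
    fix x assume "x \<in> {x. rate \<Lambda> x \<le> r \<Lambda> l u {k}}"
    then show "ereal (tilt {k} \<bullet> x) \<le> r \<Lambda> l u {k}"
      using order_trans[OF tilt_rate[of "{k}" x]] by simp
  qed (use \<Lambda>_tilt_singleton tilt_W_ge[of "{k}"] in \<open>auto simp: r_singleton\<close>)
qed (use beta_unique in blast)

text \<open>Take \<open>k\<close> in \<open>A\<close> with \<open>x $ k\<close> largest. In
  \<open>tilt {k} \<bullet> x\<close> the other coordinates in \<open>A\<close> have coefficient
  \<open>- t\<close>, so they may be replaced by \<open>x $ k\<close>; its total coefficient
  \<open>s + t - card A * t\<close> is nonnegative, so \<open>x $ k\<close> may be replaced by
  \<open>u\<close>. The surplus over \<open>2 * rbar\<close> is \<open>card A - 1\<close> times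
  \<open>u * s - u * t - 2 * (l * t)\<close>, which the dimension bound makes nonnegative.\<close>

lemma two_rbar_le:
  assumes A: "A \<noteq> {}" and x: "x \<in> W l u A" and d: "real CARD('d) \<ge> 2 + 2 * l / u"
  obtains k where "2 * rbar \<le> tilt {k} \<bullet> x + tilt A \<bullet> x"
proof -
  let ?a = "real (card A)" and ?d = "real CARD('d)"
  have "Max ((\<lambda>j. x $ j) ` A) \<in> (\<lambda>j. x $ j) ` A" using A by (intro Max_in) auto
  then obtain k where k: "k \<in> A" "x $ k = Max ((\<lambda>j. x $ j) ` A)" by auto
  have x_le: "x $ j \<le> x $ k" if "j \<in> A" for j using that unfolding k(2) by (intro Max_ge) auto
  have a: "1 \<le> ?a" "?a \<le> ?d" using card_pos_real[OF A] by (auto simp: card_mono)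
  have "(\<Sum>j\<in>UNIV. (if j \<in> {k} then (s + t) * x $ k else 0) + (if j \<in> A then - t * x $ k else t * l))
      \<le> (\<Sum>j\<in>UNIV. tilt {k} $ j * x $ j)"
  proof (rule sum_mono)
    fix j
    show "(if j \<in> {k} then (s + t) * x $ k else 0) + (if j \<in> A then - t * x $ k else t * l)
        \<le> tilt {k} $ j * x $ j"
    proof (cases "j \<in> A")
      case True
      with mult_left_mono[OF x_le[OF True] t_nonneg] show ?thesis
        by (cases "j = k") (simp_all add: tilt_def algebra_simps)
    next
      case False
      then have "x $ j < - l" using x by (simp add: W_def)
      then have "t * l \<le> t * (- x $ j)" using t_nonneg by (intro mult_left_mono) auto
      then show ?thesis using False k(1) by (auto simp: tilt_def)
    qed
  qed
  also have "\<dots> = tilt {k} \<bullet> x" by (simp add: inner_vec_def)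
  finally have 1: "(s + t - ?a * t) * x $ k + (?d - ?a) * (t * l) \<le> tilt {k} \<bullet> x"
    unfolding sum.distrib sum_if_mem by (simp add: algebra_simps)
  have "(?a - 1) * t \<le> (?d - 1) * t" using a t_nonneg by (intro mult_right_mono) auto
  also have "\<dots> \<le> s" using s_ge by (simp add: card_real)
  finally have "0 \<le> s + t - ?a * t" by (simp add: algebra_simps)
  then have "(s + t - ?a * t) * u \<le> (s + t - ?a * t) * x $ k"
    using k(1) x by (intro mult_left_mono) (auto simp: W_def less_imp_le)
  with 1 tilt_W[OF x]
  have "(s + t - ?a * t) * u + (?d - ?a) * (t * l) + (?a * (u * s) + (?d - ?a) * (l * t))
      \<le> tilt {k} \<bullet> x + tilt A \<bullet> x" by linarith
  moreover have "2 * rbar + (?a - 1) * (u * s - u * t - 2 * (l * t))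
      = (s + t - ?a * t) * u + (?d - ?a) * (t * l) + (?a * (u * s) + (?d - ?a) * (l * t))"
    by (simp add: rbar_def card_real algebra_simps)
  moreover have "(?a - 1) * (u * s - u * t - 2 * (l * t)) \<ge> 0"
  proof (intro mult_nonneg_nonneg)
    have "u + 2 * l \<le> u * (?d - 1)" using d u_pos by (simp add: field_simps)
    then have "(u + 2 * l) * t \<le> u * (?d - 1) * t" using t_nonneg by (intro mult_right_mono)
    also have "\<dots> \<le> u * s" using s_ge u_pos by (simp add: card_real mult.assoc)
    finally show "0 \<le> u * s - u * t - 2 * (l * t)" by (simp add: algebra_simps)
  qed (use a in simp)
  ultimately show ?thesis using that[of k] by linarith
qed

end

section \<open>Tilted random walks and exit times\<close>

locale iid_walk = prob_space M for M :: "'a measure" +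
  fixes X :: "nat \<Rightarrow> 'a \<Rightarrow> real ^ 'd"
  assumes indep: "indep_vars (\<lambda>_. borel) X {1..}"
    and same_distr: "i \<ge> 1 \<Longrightarrow> distr M borel (X i) = distr M borel (X 1)"
begin

text \<open>Values in \<open>ennreal\<close> let the product formulas hold without integrability
  conditions.\<close>

definition mgf :: "real ^ 'd \<Rightarrow> ennreal" where
  "mgf \<theta> = (\<integral>\<^sup>+\<omega>. ennreal (exp (\<theta> \<bullet> X 1 \<omega>)) \<partial>M)"

lemma X_measurable: "i \<ge> 1 \<Longrightarrow> X i \<in> borel_measurable M"
  using indep by (auto simp: indep_vars_def)

lemma S_measurable [measurable]: "S X n \<in> borel_measurable M"
proof -
  have "(\<lambda>\<omega>. \<Sum>i\<in>{1..n}. X i \<omega>) \<in> borel_measurable M"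
    by (intro borel_measurable_sum X_measurable) simp
  then show ?thesis by (simp add: S_def[abs_def])
qed

lemma mgf_eq:
  assumes "i \<ge> 1"
  shows "(\<integral>\<^sup>+\<omega>. ennreal (exp (\<theta> \<bullet> X i \<omega>)) \<partial>M) = mgf \<theta>"
proof -
  have distr: "(\<integral>\<^sup>+\<omega>. ennreal (exp (\<theta> \<bullet> X j \<omega>)) \<partial>M) = (\<integral>\<^sup>+x. ennreal (exp (\<theta> \<bullet> x)) \<partial>distr M borel (X j))"
    if "j \<ge> 1" for j
    by (rule nn_integral_distr[symmetric]) (use X_measurable[OF that] in auto)
  show ?thesis unfolding mgf_def distr[OF assms] distr[OF order.refl] same_distr[OF assms] ..
qed

lemma mgf_product:
  "(\<integral>\<^sup>+\<omega>. ennreal (exp (\<Sum>i\<in>{1..n}. \<theta> i \<bullet> X i \<omega>)) \<partial>M) = (\<Prod>i\<in>{1..n}. mgf (\<theta> i))"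
proof -
  have "(\<integral>\<^sup>+\<omega>. ennreal (exp (\<Sum>i\<in>{1..n}. \<theta> i \<bullet> X i \<omega>)) \<partial>M)
      = (\<integral>\<^sup>+\<omega>. (\<Prod>i\<in>{1..n}. ennreal (exp (\<theta> i \<bullet> X i \<omega>))) \<partial>M)"
    by (simp add: exp_sum prod_ennreal)
  also have "\<dots> = (\<Prod>i\<in>{1..n}. \<integral>\<^sup>+\<omega>. ennreal (exp (\<theta> i \<bullet> X i \<omega>)) \<partial>M)"
  proof (rule indep_vars_nn_integral)
    have "indep_vars (\<lambda>_. borel) X {1..n}" by (rule indep_vars_subset[OF indep]) auto
    then show "indep_vars (\<lambda>_. borel) (\<lambda>i \<omega>. ennreal (exp (\<theta> i \<bullet> X i \<omega>))) {1..n}"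
      by (rule indep_vars_compose2) measurable
  qed auto
  also have "\<dots> = (\<Prod>i\<in>{1..n}. mgf (\<theta> i))" by (intro prod.cong mgf_eq) auto
  finally show ?thesis .
qed

lemma mgf_S: "(\<integral>\<^sup>+\<omega>. ennreal (exp (\<theta> \<bullet> S X n \<omega>)) \<partial>M) = mgf \<theta> ^ n"
  using mgf_product[of "\<lambda>_. \<theta>" n] by (simp add: S_def inner_sum_right)

text \<open>The first \<open>m\<close> increments carry the exponent
  \<open>\<theta> + \<eta>\<close> and the later ones \<open>\<theta>\<close>. It controls the
  position at an earlier time under a tilt with horizon \<open>n\<close>.\<close>

lemma mgf_S_two_stage:
  assumes "m \<le> n"
  shows "(\<integral>\<^sup>+\<omega>. ennreal (exp (\<theta> \<bullet> S X n \<omega> + \<eta> \<bullet> S X m \<omega>)) \<partial>M) = mgf (\<theta> + \<eta>) ^ m * mgf \<theta> ^ (n - m)"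
proof -
  let ?\<theta> = "\<lambda>i. \<theta> + (if i \<le> m then \<eta> else 0)"
  have split: "{1..n} = {1..m} \<union> {m + 1..n}" using assms by auto
  have "(\<Sum>i\<in>{1..n}. ?\<theta> i \<bullet> X i \<omega>) = \<theta> \<bullet> S X n \<omega> + \<eta> \<bullet> S X m \<omega>" for \<omega>
  proof -
    have "(\<Sum>i\<in>{1..n}. (if i \<le> m then \<eta> else 0) \<bullet> X i \<omega>) = (\<Sum>i\<in>{1..m}. \<eta> \<bullet> X i \<omega>)"
      by (rule sum.mono_neutral_cong_right) (use assms in auto)
    then show ?thesis by (simp add: S_def inner_sum_right inner_add_left sum.distrib)
  qed
  then have "(\<integral>\<^sup>+\<omega>. ennreal (exp (\<theta> \<bullet> S X n \<omega> + \<eta> \<bullet> S X m \<omega>)) \<partial>M) = (\<Prod>i\<in>{1..n}. mgf (?\<theta> i))"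
    using mgf_product[of ?\<theta> n] by simp
  also have "\<dots> = (\<Prod>i\<in>{1..m}. mgf (?\<theta> i)) * (\<Prod>i\<in>{m + 1..n}. mgf (?\<theta> i))"
    unfolding split by (rule prod.union_disjoint) auto
  also have "(\<Prod>i\<in>{1..m}. mgf (?\<theta> i)) = mgf (\<theta> + \<eta>) ^ m" by simp
  also have "(\<Prod>i\<in>{m + 1..n}. mgf (?\<theta> i)) = (\<Prod>i\<in>{m + 1..n}. mgf \<theta>)"
    by (intro prod.cong) auto
  also have "\<dots> = mgf \<theta> ^ (n - m)" by simp
  finally show ?thesis .
qed

text \<open>A tilt with finite horizon, built on \<open>M\<close> itself, so that the lower bound
  needs no given family of tilted measures. It is a probability measure when
  \<open>mgf \<beta> = 1\<close>.\<close>

definition tilted :: "real ^ 'd \<Rightarrow> nat \<Rightarrow> 'a measure" where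
  "tilted \<beta> n = density M (\<lambda>\<omega>. ennreal (exp (\<beta> \<bullet> S X n \<omega>)))"

lemma sets_tilted [simp, measurable_cong]: "sets (tilted \<beta> n) = sets M"
  and space_tilted [simp]: "space (tilted \<beta> n) = space M"
  by (simp_all add: tilted_def)

lemma emeasure_tilted_space: "emeasure (tilted \<beta> n) (space M) = mgf \<beta> ^ n"
proof -
  have "emeasure (tilted \<beta> n) (space M)
      = (\<integral>\<^sup>+\<omega>. ennreal (exp (\<beta> \<bullet> S X n \<omega>)) * indicator (space M) \<omega> \<partial>M)"
    by (simp add: tilted_def emeasure_density)
  also have "\<dots> = (\<integral>\<^sup>+\<omega>. ennreal (exp (\<beta> \<bullet> S X n \<omega>)) \<partial>M)" by (intro nn_integral_cong) simp
  finally show ?thesis by (simp add: mgf_S)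
qed

lemma emeasure_tilted_le:
  assumes A: "A \<in> sets M" and le: "\<And>\<omega>. \<omega> \<in> A \<Longrightarrow> \<beta> \<bullet> S X n \<omega> \<le> c"
  shows "emeasure (tilted \<beta> n) A \<le> ennreal (exp c) * emeasure M A"
proof -
  have "emeasure (tilted \<beta> n) A = (\<integral>\<^sup>+\<omega>. ennreal (exp (\<beta> \<bullet> S X n \<omega>)) * indicator A \<omega> \<partial>M)"
    using A by (simp add: tilted_def emeasure_density)
  also have "\<dots> \<le> (\<integral>\<^sup>+\<omega>. ennreal (exp c) * indicator A \<omega> \<partial>M)"
    by (intro nn_integral_mono) (auto simp: indicator_def le)
  also have "\<dots> = ennreal (exp c) * emeasure M A" using A by (rule nn_integral_cmult_indicator)
  finally show ?thesis .
qed

text \<open>Exponential Markov inequality: on the event, the indicator is at most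
  \<open>exp (\<eta> * (v \<bullet> S X n \<omega> - real n * c))\<close>.\<close>

lemma tilted_tail:
  assumes \<eta>: "\<eta> \<ge> 0"
  shows "emeasure (tilted \<beta> n) {\<omega> \<in> space M. real n * c \<le> v \<bullet> S X n \<omega>}
    \<le> (mgf (\<beta> + \<eta> *\<^sub>R v) * ennreal (exp (- \<eta> * c))) ^ n"
proof -
  let ?A = "{\<omega> \<in> space M. real n * c \<le> v \<bullet> S X n \<omega>}"
  have "emeasure (tilted \<beta> n) ?A = (\<integral>\<^sup>+\<omega>. ennreal (exp (\<beta> \<bullet> S X n \<omega>)) * indicator ?A \<omega> \<partial>M)"
    by (simp add: tilted_def emeasure_density)
  also have "\<dots> \<le> (\<integral>\<^sup>+\<omega>. ennreal (exp ((\<beta> + \<eta> *\<^sub>R v) \<bullet> S X n \<omega>)) * ennreal (exp (- \<eta> * (real n * c))) \<partial>M)"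
  proof (rule nn_integral_mono)
    fix \<omega>
    have "\<eta> * (real n * c) \<le> \<eta> * (v \<bullet> S X n \<omega>)" if "\<omega> \<in> ?A"
      using that \<eta> by (intro mult_left_mono) auto
    then show "ennreal (exp (\<beta> \<bullet> S X n \<omega>)) * indicator ?A \<omega>
        \<le> ennreal (exp ((\<beta> + \<eta> *\<^sub>R v) \<bullet> S X n \<omega>)) * ennreal (exp (- \<eta> * (real n * c)))"
      by (auto simp: indicator_def inner_add_left simp flip: ennreal_mult'' exp_add intro!: ennreal_leI)
  qed
  also have "\<dots> = mgf (\<beta> + \<eta> *\<^sub>R v) ^ n * ennreal (exp (- \<eta> * (real n * c)))"
    by (simp add: nn_integral_multc mgf_S)
  also have "exp (- \<eta> * (real n * c)) = exp (- \<eta> * c) ^ n"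
    by (simp add: exp_of_nat_mult[symmetric] algebra_simps)
  finally show ?thesis by (simp add: power_mult_distrib ennreal_power)
qed

text \<open>The same inequality at an earlier time \<open>m\<close>; since both generating functions
  are at most \<open>1\<close>, the bound is uniform in \<open>m\<close> and
  \<open>n\<close>.\<close>

lemma tilted_return:
  assumes \<eta>: "\<eta> \<ge> 0" and m: "m \<le> n" and \<beta>: "mgf \<beta> \<le> 1" "mgf (\<beta> + \<eta> *\<^sub>R v) \<le> 1"
  shows "emeasure (tilted \<beta> n) {\<omega> \<in> space M. c \<le> v \<bullet> S X m \<omega>} \<le> ennreal (exp (- \<eta> * c))"
proof -
  let ?A = "{\<omega> \<in> space M. c \<le> v \<bullet> S X m \<omega>}"
  have "emeasure (tilted \<beta> n) ?A = (\<integral>\<^sup>+\<omega>. ennreal (exp (\<beta> \<bullet> S X n \<omega>)) * indicator ?A \<omega> \<partial>M)"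
    by (simp add: tilted_def emeasure_density)
  also have "\<dots> \<le> (\<integral>\<^sup>+\<omega>. ennreal (exp (\<beta> \<bullet> S X n \<omega> + (\<eta> *\<^sub>R v) \<bullet> S X m \<omega>)) * ennreal (exp (- \<eta> * c)) \<partial>M)"
  proof (rule nn_integral_mono)
    fix \<omega>
    have "\<eta> * c \<le> \<eta> * (v \<bullet> S X m \<omega>)" if "\<omega> \<in> ?A"
      using that \<eta> by (intro mult_left_mono) auto
    then show "ennreal (exp (\<beta> \<bullet> S X n \<omega>)) * indicator ?A \<omega>
        \<le> ennreal (exp (\<beta> \<bullet> S X n \<omega> + (\<eta> *\<^sub>R v) \<bullet> S X m \<omega>)) * ennreal (exp (- \<eta> * c))"
      by (auto simp: indicator_def simp flip: ennreal_mult'' exp_add intro!: ennreal_leI)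
  qed
  also have "\<dots> = mgf (\<beta> + \<eta> *\<^sub>R v) ^ m * mgf \<beta> ^ (n - m) * ennreal (exp (- \<eta> * c))"
    by (subst nn_integral_multc) (measurable, simp only: mgf_S_two_stage[OF m])
  also have "\<dots> \<le> 1 * 1 * ennreal (exp (- \<eta> * c))"
    using \<beta> by (intro mult_mono power_le_one) auto
  finally show ?thesis by simp
qed

end

section \<open>Hitting times and the decomposition of the rare event by exit time\<close>

lemma mem_scaled_W: "b > 0 \<Longrightarrow> y \<in> (\<lambda>x. b *\<^sub>R x) ` W l u A \<longleftrightarrow> y \<in> W (b * l) (b * u) A"
proof -
  assume b: "b > 0"
  have "y \<in> (\<lambda>x. b *\<^sub>R x) ` W l u A \<longleftrightarrow> (1 / b) *\<^sub>R y \<in> W l u A"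
    using b by (force intro: image_eqI[of _ _ "(1 / b) *\<^sub>R y"])
  also have "\<dots> \<longleftrightarrow> y \<in> W (b * l) (b * u) A"
    using b by (auto simp: W_def field_simps)
  finally show ?thesis .
qed

lemma Inf_enat_le_iff: "Inf {enat n | n. P n} \<le> enat n \<longleftrightarrow> (\<exists>m\<le>n. P m)"
proof
  assume le: "Inf {enat n | n. P n} \<le> enat n"
  have ne: "{enat n | n. P n} \<noteq> {}"
  proof
    assume "{enat n | n. P n} = {}"
    with le show False by (simp only: Inf_empty) (simp add: top_enat_def)
  qed
  then obtain x where "x \<in> {enat n | n. P n}" by blast
  then have "(LEAST x. x \<in> {enat n | n. P n}) \<in> {enat n | n. P n}" by (rule LeastI)
  then have "Inf {enat n | n. P n} \<in> {enat n | n. P n}" using ne by (simp only: Inf_enat_def if_False)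
  with le show "\<exists>m\<le>n. P m" by auto
next
  assume "\<exists>m\<le>n. P m"
  then obtain m where "m \<le> n" "P m" by auto
  then have "Inf {enat n | n. P n} \<le> enat m" by (intro Inf_lower) auto
  also have "\<dots> \<le> enat n" using \<open>m \<le> n\<close> by simp
  finally show "Inf {enat n | n. P n} \<le> enat n" .
qed

lemma tau_le_iff:
  "b > 0 \<Longrightarrow> tau X l u b A \<omega> \<le> enat n \<longleftrightarrow> (\<exists>m\<le>n. S X m \<omega> \<in> W (b * l) (b * u) A)"
  by (simp add: tau_def mem_scaled_W Inf_enat_le_iff)

lemma tau_star_le_iff: "tau_star X l u b \<omega> \<le> c \<longleftrightarrow> (\<exists>A\<noteq>{}. tau X l u b A \<omega> \<le> c)"
  unfolding tau_star_def by (subst Min_le_iff) auto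

text \<open>The hitting time of the all-negative region is compared with \<open>n\<close> instead of
  \<open>tau_star\<close>, so that membership depends on the path up to time \<open>n\<close>
  only.\<close>

definition exit_at :: "'w measure \<Rightarrow> (nat \<Rightarrow> 'w \<Rightarrow> real ^ 'd) \<Rightarrow> real \<Rightarrow> real \<Rightarrow> real \<Rightarrow> nat \<Rightarrow> 'w set" where
  "exit_at M X l u b n =
     {\<omega> \<in> space M. tau_star X l u b \<omega> = enat n \<and> \<not> tau X l u b {} \<omega> \<le> enat n}"

lemma rare_event_eq: "rare_event M X l u b = (\<Union>n. exit_at M X l u b n)"
proof (intro set_eqI iffI)
  fix \<omega> assume "\<omega> \<in> rare_event M X l u b"
  then have *: "\<omega> \<in> space M" "tau_star X l u b \<omega> < tau X l u b {} \<omega>" by (auto simp: rare_event_def)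
  then obtain n where "tau_star X l u b \<omega> = enat n" by (cases "tau_star X l u b \<omega>") auto
  with * show "\<omega> \<in> (\<Union>n. exit_at M X l u b n)" by (auto simp: exit_at_def not_le)
qed (auto simp: exit_at_def rare_event_def not_le)

lemma disjoint_exit_at: "disjoint_family (exit_at M X l u b)"
  by (auto simp: disjoint_family_on_def exit_at_def)

lemma exit_at_subset: "exit_at M X l u b n \<subseteq> rare_event M X l u b"
  unfolding rare_event_eq by blast

text \<open>A hitting time \<open>m \<le> n\<close> of some \<open>A\<close> bounds
  \<open>tau_star\<close> from above, so minimality forces \<open>m = n\<close>.\<close>

lemma exit_atD:
  assumes "b > 0" "\<omega> \<in> exit_at M X l u b n"
  obtains A where "A \<noteq> {}" "S X n \<omega> \<in> W (b * l) (b * u) A"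
proof -
  have n: "tau_star X l u b \<omega> = enat n" using assms(2) by (simp add: exit_at_def)
  then obtain A where A: "A \<noteq> {}" "tau X l u b A \<omega> \<le> enat n"
    using tau_star_le_iff[of X l u b \<omega> "enat n"] by auto
  then obtain m where m: "m \<le> n" "S X m \<omega> \<in> W (b * l) (b * u) A"
    by (auto simp: tau_le_iff[OF assms(1)])
  then have "tau X l u b A \<omega> \<le> enat m" by (auto simp: tau_le_iff[OF assms(1)])
  then have "tau_star X l u b \<omega> \<le> enat m" using A(1) by (auto simp: tau_star_le_iff)
  then have "m = n" using n m(1) by simp
  then show ?thesis using that A(1) m(2) by blast
qed

section \<open>Change of measure along the exit time\<close>

lemma W_borel [measurable]: "W l u A \<in> sets borel"
proof -
  have "{x \<in> space borel. (\<forall>k\<in>A. x $ k > u) \<and> (\<forall>k. k \<notin> A \<longrightarrow> x $ k < - l)} \<in> sets borel"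
    by measurable
  then show ?thesis by (simp add: W_def)
qed

lemma tau_star_eq_iff:
  "tau_star X l u b \<omega> = enat n \<longleftrightarrow>
    tau_star X l u b \<omega> \<le> enat n \<and> (\<forall>m<n. \<not> tau_star X l u b \<omega> \<le> enat m)"
proof
  assume R: "tau_star X l u b \<omega> \<le> enat n \<and> (\<forall>m<n. \<not> tau_star X l u b \<omega> \<le> enat m)"
  then obtain j where j: "tau_star X l u b \<omega> = enat j" "j \<le> n"
    by (cases "tau_star X l u b \<omega>") auto
  have "\<not> j < n"
  proof
    assume "j < n"
    with R have "\<not> tau_star X l u b \<omega> \<le> enat j" by blast
    with j(1) show False by simp
  qed
  with j show "tau_star X l u b \<omega> = enat n" by simp
qed auto

text \<open>\<open>mixture\<close> applies \<open>measure_of\<close> to a set function whose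
  countable additivity has to be established. Identifying it with a monadic bind over the uniform
  distribution on \<open>\<Theta>\<close> does this and supplies the integral formula.\<close>

lemma mixture_eq_bind:
  fixes P :: "real ^ 'd \<Rightarrow> 'w measure"
  assumes fin: "finite \<Theta>" and ne: "\<Theta> \<noteq> {}"
    and P: "\<And>\<theta>. \<theta> \<in> \<Theta> \<Longrightarrow> prob_space (P \<theta>)" "\<And>\<theta>. \<theta> \<in> \<Theta> \<Longrightarrow> sets (P \<theta>) = sets M"
  obtains P' where "\<And>\<theta>. \<theta> \<in> \<Theta> \<Longrightarrow> P' \<theta> = P \<theta>"
    "P' \<in> measurable (measure_pmf (pmf_of_set \<Theta>)) (subprob_algebra M)"
    "mixture M P \<Theta> = measure_pmf (pmf_of_set \<Theta>) \<bind> P'"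
proof -
  obtain \<theta>0 where \<theta>0: "\<theta>0 \<in> \<Theta>" using ne by auto
  \<comment> \<open>Off \<open>\<Theta>\<close> the family is arbitrary; it is replaced there by one
    of its probability measures to make it a kernel on the whole type.\<close>
  define P' where "P' \<theta> = (if \<theta> \<in> \<Theta> then P \<theta> else P \<theta>0)" for \<theta>
  let ?p = "measure_pmf (pmf_of_set \<Theta>)"
  have P': "prob_space (P' \<theta>)" "sets (P' \<theta>) = sets M" for \<theta>
    using P \<theta>0 by (auto simp: P'_def)
  have meas: "P' \<in> measurable ?p (subprob_algebra M)"
    using P' by (auto simp: space_subprob_algebra prob_space_imp_subprob_space)
  have sets_N: "sets (?p \<bind> P') = sets M" by (rule sets_bind) (use P' in auto)
  have space_N: "space (?p \<bind> P') = space M" by (rule sets_eq_imp_space_eq[OF sets_N])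
  have "mixture M P \<Theta> = measure_of (space M) (sets M) (emeasure (?p \<bind> P'))"
    unfolding mixture_def
  proof (rule measure_of_eq[OF sets.space_closed])
    fix A assume "A \<in> sigma_sets (space M) (sets M)"
    then have A: "A \<in> sets M" by (simp add: sets.sigma_sets_eq)
    have "emeasure (?p \<bind> P') A = (\<integral>\<^sup>+\<theta>. emeasure (P' \<theta>) A \<partial>?p)"
      by (rule emeasure_bind[OF _ meas A]) simp
    also have "\<dots> = (\<Sum>\<theta>\<in>\<Theta>. emeasure (P' \<theta>) A) / of_nat (card \<Theta>)"
      using nn_integral_pmf_of_set[OF ne fin] by (simp add: ennreal_of_nat_eq_real_of_nat)
    also have "(\<Sum>\<theta>\<in>\<Theta>. emeasure (P' \<theta>) A) = (\<Sum>\<theta>\<in>\<Theta>. emeasure (P \<theta>) A)"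
      by (intro sum.cong) (auto simp: P'_def)
    finally show "(\<Sum>\<theta>\<in>\<Theta>. emeasure (P \<theta>) A) / of_nat (card \<Theta>) = emeasure (?p \<bind> P') A" ..
  qed
  also have "\<dots> = ?p \<bind> P'"
    using measure_of_of_measure[of "?p \<bind> P'"] by (simp add: sets_N space_N)
  finally show ?thesis using meas by (intro that) (auto simp: P'_def)
qed

lemma
  fixes P :: "real ^ 'd \<Rightarrow> 'w measure"
  assumes fin: "finite \<Theta>" and ne: "\<Theta> \<noteq> {}"
    and P: "\<And>\<theta>. \<theta> \<in> \<Theta> \<Longrightarrow> prob_space (P \<theta>)" "\<And>\<theta>. \<theta> \<in> \<Theta> \<Longrightarrow> sets (P \<theta>) = sets M"
  shows sets_mixture: "sets (mixture M P \<Theta>) = sets M"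
    and nn_integral_mixture: "f \<in> borel_measurable M \<Longrightarrow>
      (\<integral>\<^sup>+\<omega>. f \<omega> \<partial>mixture M P \<Theta>) = (\<Sum>\<theta>\<in>\<Theta>. \<integral>\<^sup>+\<omega>. f \<omega> \<partial>P \<theta>) / of_nat (card \<Theta>)"
proof -
  let ?p = "measure_pmf (pmf_of_set \<Theta>)"
  obtain P' where P': "\<And>\<theta>. \<theta> \<in> \<Theta> \<Longrightarrow> P' \<theta> = P \<theta>"
    "P' \<in> measurable ?p (subprob_algebra M)" "mixture M P \<Theta> = ?p \<bind> P'"
    using mixture_eq_bind[of \<Theta> P M, OF assms] by blast
  show "sets (mixture M P \<Theta>) = sets M" by (simp add: mixture_def)
  assume f: "f \<in> borel_measurable M"
  have "(\<integral>\<^sup>+\<omega>. f \<omega> \<partial>mixture M P \<Theta>) = (\<integral>\<^sup>+\<theta>. \<integral>\<^sup>+\<omega>. f \<omega> \<partial>P' \<theta> \<partial>?p)"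
    unfolding P'(3) by (rule nn_integral_bind[OF f P'(2)])
  also have "\<dots> = (\<Sum>\<theta>\<in>\<Theta>. \<integral>\<^sup>+\<omega>. f \<omega> \<partial>P' \<theta>) / of_nat (card \<Theta>)"
    using nn_integral_pmf_of_set[OF ne fin] by (simp add: ennreal_of_nat_eq_real_of_nat)
  also have "(\<Sum>\<theta>\<in>\<Theta>. \<integral>\<^sup>+\<omega>. f \<omega> \<partial>P' \<theta>) = (\<Sum>\<theta>\<in>\<Theta>. \<integral>\<^sup>+\<omega>. f \<omega> \<partial>P \<theta>)"
    by (intro sum.cong) (auto simp: P'(1))
  finally show "(\<integral>\<^sup>+\<omega>. f \<omega> \<partial>mixture M P \<Theta>) = (\<Sum>\<theta>\<in>\<Theta>. \<integral>\<^sup>+\<omega>. f \<omega> \<partial>P \<theta>) / of_nat (card \<Theta>)" .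
qed

section \<open>Likelihood ratios on the filtration and at the exit time\<close>

context iid_walk
begin

lemma hist_generator: "(\<Union>i\<in>{1..n}. {X i -` B \<inter> space M | B. B \<in> sets borel}) \<subseteq> sets M"
  using X_measurable by (auto intro: measurable_sets)

lemma sets_hist:
  "sets (hist M X n) = sigma_sets (space M) (\<Union>i\<in>{1..n}. {X i -` B \<inter> space M | B. B \<in> sets borel})"
  unfolding hist_def using hist_generator[of n] sets.space_closed by (intro sets_measure_of) blast

lemma space_hist [simp]: "space (hist M X n) = space M"
  unfolding hist_def using hist_generator[of n] sets.space_closed by (intro space_measure_of) blast

lemma subalgebra_hist: "subalgebra M (hist M X n)"
  unfolding subalgebra_def sets_hist using hist_generator[of n] by (simp add: sets.sigma_sets_subset)

lemma X_hist: "1 \<le> i \<Longrightarrow> i \<le> n \<Longrightarrow> X i \<in> borel_measurable (hist M X n)"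
proof (rule measurableI)
  fix B :: "(real ^ 'd) set" assume "1 \<le> i" "i \<le> n" "B \<in> sets borel"
  then have "X i -` B \<inter> space M \<in> (\<Union>i\<in>{1..n}. {X i -` B \<inter> space M | B. B \<in> sets borel})"
    by (intro UN_I[of i]) auto
  then show "X i -` B \<inter> space (hist M X n) \<in> sets (hist M X n)"
    unfolding sets_hist space_hist by (rule sigma_sets.Basic)
qed simp

lemma S_hist: "m \<le> n \<Longrightarrow> S X m \<in> borel_measurable (hist M X n)"
  unfolding S_def[abs_def] by (intro borel_measurable_sum X_hist) auto

lemma hit_hist: "m \<le> n \<Longrightarrow> Measurable.pred (hist M X n) (\<lambda>\<omega>. S X m \<omega> \<in> W l u A)"
  using S_hist[of m n] W_borel[of l u A] by measurable

lemma exit_at_hist: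
  assumes "b > 0"
  shows "exit_at M X l u b n \<in> sets (hist M X n)"
proof -
  note [measurable] = hit_hist
  have "exit_at M X l u b n = {\<omega> \<in> space (hist M X n).
      (\<exists>A\<in>{A. A \<noteq> {}}. \<exists>m\<in>{..n}. S X m \<omega> \<in> W (b * l) (b * u) A)
      \<and> (\<forall>j\<in>{..<n}. \<not> (\<exists>A\<in>{A. A \<noteq> {}}. \<exists>m\<in>{..j}. S X m \<omega> \<in> W (b * l) (b * u) A))
      \<and> \<not> (\<exists>m\<in>{..n}. S X m \<omega> \<in> W (b * l) (b * u) {})}"
    unfolding exit_at_def tau_star_eq_iff tau_star_le_iff tau_le_iff[OF assms] by auto
  also have "\<dots> \<in> sets (hist M X n)"
    by (intro predE pred_intros_finite pred_intros_logic hit_hist) auto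
  finally show ?thesis .
qed

lemma exit_at_sets: "b > 0 \<Longrightarrow> exit_at M X l u b n \<in> sets M"
  using exit_at_hist[of b l u n] subalgebra_hist[of n] by (auto simp: subalgebra_def)

lemma rare_event_sets: "b > 0 \<Longrightarrow> rare_event M X l u b \<in> sets M"
  unfolding rare_event_eq using exit_at_sets by blast

text \<open>The density is known on the history up to \<open>n\<close> only. Both integrals of a
  history-measurable function may be taken over the restricted measures, where it applies.\<close>

lemma nn_integral_exp_tilt:
  assumes Q: "exp_tilt M X \<Lambda> \<theta> Q" and g: "g \<in> borel_measurable (hist M X n)"
  shows "(\<integral>\<^sup>+\<omega>. g \<omega> \<partial>Q)
    = (\<integral>\<^sup>+\<omega>. ennreal (exp (\<theta> \<bullet> S X n \<omega> - real n * real_of_ereal (\<Lambda> \<theta>))) * g \<omega> \<partial>M)"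
proof -
  let ?F = "hist M X n" and ?w = "\<lambda>\<omega>. ennreal (exp (\<theta> \<bullet> S X n \<omega> - real n * real_of_ereal (\<Lambda> \<theta>)))"
  have sets_Q: "sets Q = sets M"
    and restr: "restr_to_subalg Q ?F = density (restr_to_subalg M ?F) ?w"
    using Q by (auto simp: exp_tilt_def)
  have sub_Q: "subalgebra Q ?F"
    using subalgebra_hist sets_Q sets_eq_imp_space_eq[OF sets_Q] by (auto simp: subalgebra_def)
  have w: "?w \<in> borel_measurable ?F" using S_hist[OF order.refl, of n] by simp
  have "(\<integral>\<^sup>+\<omega>. g \<omega> \<partial>Q) = (\<integral>\<^sup>+\<omega>. g \<omega> \<partial>density (restr_to_subalg M ?F) ?w)"
    unfolding restr[symmetric] by (rule nn_integral_subalgebra2[OF sub_Q g, symmetric])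
  also have "\<dots> = (\<integral>\<^sup>+\<omega>. ?w \<omega> * g \<omega> \<partial>restr_to_subalg M ?F)"
    using measurable_in_subalg[OF subalgebra_hist w] measurable_in_subalg[OF subalgebra_hist g]
    by (rule nn_integral_density)
  also have "\<dots> = (\<integral>\<^sup>+\<omega>. ?w \<omega> * g \<omega> \<partial>M)"
    by (rule nn_integral_subalgebra2[OF subalgebra_hist]) (use w g in measurable)
  finally show ?thesis .
qed

text \<open>The density of the mixture with respect to \<open>M\<close> on the history up to
  \<open>n\<close>, as \<open>nn_integral_mixture_hist\<close> shows.\<close>

definition likelihood ::
    "(real ^ 'd \<Rightarrow> ereal) \<Rightarrow> (real ^ 'd) set \<Rightarrow> nat \<Rightarrow> 'a \<Rightarrow> real" where
  "likelihood \<Lambda> \<Theta> n \<omega> =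
     (\<Sum>\<theta>\<in>\<Theta>. exp (\<theta> \<bullet> S X n \<omega> - real n * real_of_ereal (\<Lambda> \<theta>))) / real (card \<Theta>)"

lemma likelihood_hist: "likelihood \<Lambda> \<Theta> n \<in> borel_measurable (hist M X n)"
  unfolding likelihood_def[abs_def] using S_hist[OF order.refl, of n] by measurable

lemma likelihood_pos: "finite \<Theta> \<Longrightarrow> \<Theta> \<noteq> {} \<Longrightarrow> 0 < likelihood \<Lambda> \<Theta> n \<omega>"
  unfolding likelihood_def by (intro divide_pos_pos sum_pos) (auto simp: card_gt_0_iff)

lemma estimator_exit_at:
  "\<omega> \<in> exit_at M X l u b n \<Longrightarrow> estimator M X \<Lambda> l u \<Theta> b \<omega> = inverse (likelihood \<Lambda> \<Theta> n \<omega>)"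
  using exit_at_subset[of M X l u b n]
  by (auto simp: estimator_def likelihood_def exit_at_def Let_def)

lemma measurable_hist_imp: "g \<in> measurable (hist M X n) N \<Longrightarrow> g \<in> measurable M N"
  by (rule measurable_from_subalg[OF subalgebra_hist])

text \<open>At most one indicator is nonzero, so the series is a way of evaluating \<open>g\<close>
  at the random exit time.\<close>

lemma suminf_exit_at:
  fixes g :: "nat \<Rightarrow> 'a \<Rightarrow> ennreal"
  assumes "\<omega> \<in> exit_at M X l u b n"
  shows "(\<Sum>i. g i \<omega> * indicator (exit_at M X l u b i) \<omega>) = g n \<omega>"
proof -
  have "(\<lambda>i. g i \<omega> * indicator (exit_at M X l u b i) \<omega>) = (\<lambda>i. if i = n then g i \<omega> else 0)"
    using assms disjoint_exit_at[of M X l u b] by (auto simp: fun_eq_iff indicator_def disjoint_family_on_def)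
  then show ?thesis using sums_unique[OF sums_single[of n "\<lambda>i. g i \<omega>"]] by simp
qed

lemma suminf_not_rare:
  fixes g :: "nat \<Rightarrow> 'a \<Rightarrow> ennreal"
  assumes "\<omega> \<notin> rare_event M X l u b"
  shows "(\<Sum>i. g i \<omega> * indicator (exit_at M X l u b i) \<omega>) = 0"
proof -
  have "(\<lambda>i. g i \<omega> * indicator (exit_at M X l u b i) \<omega>) = (\<lambda>_. 0)"
    using assms exit_at_subset[of M X l u b] by (auto simp: fun_eq_iff indicator_def)
  then show ?thesis by simp
qed

text \<open>The change of measure is available on each \<open>hist M X n\<close> only, so integrals over the rare
  event are split along the exit time.\<close>

context
  fixes \<Lambda> :: "real ^ 'd \<Rightarrow> ereal" and \<Theta> :: "(real ^ 'd) set" and P :: "real ^ 'd \<Rightarrow> 'a measure"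
    and l u b :: real
  assumes fin: "finite \<Theta>" and ne: "\<Theta> \<noteq> {}" and b: "b > 0"
    and P: "\<And>\<theta>. \<theta> \<in> \<Theta> \<Longrightarrow> exp_tilt M X \<Lambda> \<theta> (P \<theta>)"
begin

lemma P_prob: "\<theta> \<in> \<Theta> \<Longrightarrow> prob_space (P \<theta>)" and P_sets: "\<theta> \<in> \<Theta> \<Longrightarrow> sets (P \<theta>) = sets M"
  using P by (auto simp: exp_tilt_def)

lemma sets_mixture_M [measurable_cong]: "sets (mixture M P \<Theta>) = sets M"
  by (rule sets_mixture[OF fin ne P_prob P_sets])

lemma nn_integral_mixture_hist:
  assumes g: "g \<in> borel_measurable (hist M X n)"
  shows "(\<integral>\<^sup>+\<omega>. g \<omega> \<partial>mixture M P \<Theta>) = (\<integral>\<^sup>+\<omega>. ennreal (likelihood \<Lambda> \<Theta> n \<omega>) * g \<omega> \<partial>M)"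
proof -
  let ?w = "\<lambda>\<theta> \<omega>. exp (\<theta> \<bullet> S X n \<omega> - real n * real_of_ereal (\<Lambda> \<theta>))"
  have c: "real (card \<Theta>) > 0" using fin ne by (simp add: card_gt_0_iff)
  have [measurable]: "g \<in> borel_measurable M" by (rule measurable_hist_imp[OF g])
  have "(\<integral>\<^sup>+\<omega>. g \<omega> \<partial>mixture M P \<Theta>) = (\<Sum>\<theta>\<in>\<Theta>. \<integral>\<^sup>+\<omega>. g \<omega> \<partial>P \<theta>) / of_nat (card \<Theta>)"
    by (rule nn_integral_mixture[OF fin ne P_prob P_sets]) simp_all
  also have "(\<Sum>\<theta>\<in>\<Theta>. \<integral>\<^sup>+\<omega>. g \<omega> \<partial>P \<theta>) = (\<Sum>\<theta>\<in>\<Theta>. \<integral>\<^sup>+\<omega>. ennreal (?w \<theta> \<omega>) * g \<omega> \<partial>M)"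
    by (intro sum.cong nn_integral_exp_tilt[OF P g]) auto
  also have "\<dots> = (\<integral>\<^sup>+\<omega>. ennreal (\<Sum>\<theta>\<in>\<Theta>. ?w \<theta> \<omega>) * g \<omega> \<partial>M)"
    by (subst nn_integral_sum[symmetric])
      (auto intro!: nn_integral_cong simp: sum_distrib_right sum_ennreal[symmetric] simp del: sum_ennreal)
  also have "\<dots> / of_nat (card \<Theta>) = (\<integral>\<^sup>+\<omega>. ennreal (\<Sum>\<theta>\<in>\<Theta>. ?w \<theta> \<omega>) * g \<omega> / of_nat (card \<Theta>) \<partial>M)"
    by (rule nn_integral_divide[symmetric]) simp
  also have "\<dots> = (\<integral>\<^sup>+\<omega>. ennreal (likelihood \<Lambda> \<Theta> n \<omega>) * g \<omega> \<partial>M)"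
  proof (rule nn_integral_cong)
    fix \<omega>
    have "ennreal (likelihood \<Lambda> \<Theta> n \<omega>) = ennreal (\<Sum>\<theta>\<in>\<Theta>. ?w \<theta> \<omega>) / of_nat (card \<Theta>)"
      unfolding likelihood_def using c
      by (simp add: divide_ennreal[symmetric] sum_nonneg ennreal_of_nat_eq_real_of_nat)
    then show "ennreal (\<Sum>\<theta>\<in>\<Theta>. ?w \<theta> \<omega>) * g \<omega> / of_nat (card \<Theta>) = ennreal (likelihood \<Lambda> \<Theta> n \<omega>) * g \<omega>"
      by (simp add: ennreal_times_divide mult.commute)
  qed
  finally show ?thesis .
qed

lemma nn_integral_mixture_exit:
  assumes g: "\<And>n. g n \<in> borel_measurable (hist M X n)"
  shows "(\<integral>\<^sup>+\<omega>. (\<Sum>n. g n \<omega> * indicator (exit_at M X l u b n) \<omega>) \<partial>mixture M P \<Theta>)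
    = (\<integral>\<^sup>+\<omega>. (\<Sum>n. ennreal (likelihood \<Lambda> \<Theta> n \<omega>) * g n \<omega> * indicator (exit_at M X l u b n) \<omega>) \<partial>M)"
proof -
  have gE: "(\<lambda>\<omega>. g n \<omega> * indicator (exit_at M X l u b n) \<omega>) \<in> borel_measurable (hist M X n)" for n
    using g[of n] exit_at_hist[OF b, of l u n] by measurable
  note gE' = measurable_hist_imp[OF gE]
  have "(\<integral>\<^sup>+\<omega>. (\<Sum>n. g n \<omega> * indicator (exit_at M X l u b n) \<omega>) \<partial>mixture M P \<Theta>)
      = (\<Sum>n. \<integral>\<^sup>+\<omega>. g n \<omega> * indicator (exit_at M X l u b n) \<omega> \<partial>mixture M P \<Theta>)"
    by (rule nn_integral_suminf) (use gE' in measurable)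
  also have "\<dots> = (\<Sum>n. \<integral>\<^sup>+\<omega>. ennreal (likelihood \<Lambda> \<Theta> n \<omega>) * (g n \<omega> * indicator (exit_at M X l u b n) \<omega>) \<partial>M)"
    by (simp only: nn_integral_mixture_hist[OF gE])
  also have "\<dots> = (\<integral>\<^sup>+\<omega>. (\<Sum>n. ennreal (likelihood \<Lambda> \<Theta> n \<omega>) * (g n \<omega> * indicator (exit_at M X l u b n) \<omega>)) \<partial>M)"
    by (rule nn_integral_suminf[symmetric])
      (use gE' measurable_hist_imp[OF likelihood_hist] in measurable)
  finally show ?thesis by (simp only: mult.assoc)
qed

text \<open>The squared estimator is the inverse square of the likelihood ratio, and passing from
  the mixture to \<open>M\<close> multiplies by that ratio once.\<close>

lemma second_moment_eq:
  "(\<integral>\<^sup>+\<omega>. ennreal ((estimator M X \<Lambda> l u \<Theta> b \<omega>)\<^sup>2) \<partial>mixture M P \<Theta>)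
    = (\<integral>\<^sup>+\<omega>. (\<Sum>n. ennreal (inverse (likelihood \<Lambda> \<Theta> n \<omega>)) * indicator (exit_at M X l u b n) \<omega>) \<partial>M)"
proof -
  let ?g = "\<lambda>n \<omega>. ennreal ((inverse (likelihood \<Lambda> \<Theta> n \<omega>))\<^sup>2)"
  have "(\<integral>\<^sup>+\<omega>. ennreal ((estimator M X \<Lambda> l u \<Theta> b \<omega>)\<^sup>2) \<partial>mixture M P \<Theta>)
      = (\<integral>\<^sup>+\<omega>. (\<Sum>n. ?g n \<omega> * indicator (exit_at M X l u b n) \<omega>) \<partial>mixture M P \<Theta>)"
  proof (rule nn_integral_cong)
    fix \<omega>
    show "ennreal ((estimator M X \<Lambda> l u \<Theta> b \<omega>)\<^sup>2) = (\<Sum>n. ?g n \<omega> * indicator (exit_at M X l u b n) \<omega>)"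
    proof (cases "\<omega> \<in> rare_event M X l u b")
      case True
      then obtain n where n: "\<omega> \<in> exit_at M X l u b n" unfolding rare_event_eq by blast
      show ?thesis
        by (simp only: suminf_exit_at[OF n, where g = ?g] estimator_exit_at[OF n])
    next
      case False
      then show ?thesis
        by (simp only: suminf_not_rare[OF False, where g = ?g]) (simp add: estimator_def Let_def)
    qed
  qed
  also have "\<dots> = (\<integral>\<^sup>+\<omega>. (\<Sum>n. ennreal (likelihood \<Lambda> \<Theta> n \<omega>) * ?g n \<omega> * indicator (exit_at M X l u b n) \<omega>) \<partial>M)"
    by (rule nn_integral_mixture_exit) (use likelihood_hist in measurable)
  also have "\<dots> = (\<integral>\<^sup>+\<omega>. (\<Sum>n. ennreal (inverse (likelihood \<Lambda> \<Theta> n \<omega>)) * indicator (exit_at M X l u b n) \<omega>) \<partial>M)"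
  proof -
    have "ennreal (likelihood \<Lambda> \<Theta> n \<omega>) * ?g n \<omega> = ennreal (inverse (likelihood \<Lambda> \<Theta> n \<omega>))" for n \<omega>
      using likelihood_pos[OF fin ne, of \<Lambda> n \<omega>]
      by (simp add: power2_eq_square less_imp_le flip: ennreal_mult)
    then show ?thesis by simp
  qed
  finally show ?thesis .
qed

text \<open>The left side is the probability of the rare event under the mixture.\<close>

lemma likelihood_mass:
  "(\<integral>\<^sup>+\<omega>. (\<Sum>n. ennreal (likelihood \<Lambda> \<Theta> n \<omega>) * indicator (exit_at M X l u b n) \<omega>) \<partial>M) \<le> 1"
proof -
  have "(\<Sum>n. 1 * indicator (exit_at M X l u b n) \<omega>) \<le> (1 :: ennreal)" for \<omega>
  proof (cases "\<omega> \<in> rare_event M X l u b")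
    case True
    then obtain n where n: "\<omega> \<in> exit_at M X l u b n" unfolding rare_event_eq by blast
    show ?thesis by (simp only: suminf_exit_at[OF n, where g = "\<lambda>_ _. 1"])
  next
    case False
    show ?thesis by (simp only: suminf_not_rare[OF False, where g = "\<lambda>_ _. 1"]) simp
  qed
  then have "(\<integral>\<^sup>+\<omega>. (\<Sum>n. 1 * indicator (exit_at M X l u b n) \<omega>) \<partial>mixture M P \<Theta>)
      \<le> (\<integral>\<^sup>+\<omega>. 1 \<partial>mixture M P \<Theta>)" by (intro nn_integral_mono)
  also have "\<dots> = (\<Sum>\<theta>\<in>\<Theta>. \<integral>\<^sup>+\<omega>. 1 \<partial>P \<theta>) / of_nat (card \<Theta>)"
    by (rule nn_integral_mixture[OF fin ne P_prob P_sets]) simp_all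
  also have "(\<Sum>\<theta>\<in>\<Theta>. \<integral>\<^sup>+\<omega>. 1 \<partial>P \<theta>) = (\<Sum>\<theta>\<in>\<Theta>. 1)"
    by (intro sum.cong) (auto simp: prob_space.emeasure_space_1[OF P_prob])
  also have "\<dots> / of_nat (card \<Theta>) = 1"
  proof -
    have "of_nat (card \<Theta>) / (of_nat (card \<Theta>) :: ennreal) = 1"
      by (rule ennreal_divide_self) (use fin ne in \<open>auto simp: card_gt_0_iff of_nat_less_top\<close>)
    then show ?thesis by simp
  qed
  finally show ?thesis
    by (subst (asm) nn_integral_mixture_exit) simp_all
qed

text \<open>Cauchy-Schwarz through the pointwise inequality
  \<open>2 * p \<le> inverse z + p\<^sup>2 * z\<close>. Integrated over the rare event it gives
  twice the squared probability on the left, of which one copy is cancelled by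
  \<open>likelihood_mass\<close>.\<close>

lemma second_moment_ge:
  "(emeasure M (rare_event M X l u b))\<^sup>2
    \<le> (\<integral>\<^sup>+\<omega>. ennreal ((estimator M X \<Lambda> l u \<Theta> b \<omega>)\<^sup>2) \<partial>mixture M P \<Theta>)" (is "_ \<le> ?m2")
proof -
  let ?R = "rare_event M X l u b" and ?Z = "likelihood \<Lambda> \<Theta>" and ?E = "exit_at M X l u b"
  define p where "p = measure M ?R"
  have p: "emeasure M ?R = ennreal p" "p \<ge> 0" by (simp_all add: p_def emeasure_eq_measure)
  have [measurable]: "?Z n \<in> borel_measurable M" for n
    by (rule measurable_hist_imp[OF likelihood_hist])
  have [measurable]: "?E n \<in> sets M" for n by (rule exit_at_sets[OF b])
  have "ennreal (p\<^sup>2) + ennreal (p\<^sup>2) = ennreal (2 * p) * emeasure M ?R"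
    using p by (simp add: power2_eq_square flip: ennreal_mult ennreal_plus)
  also have "\<dots> = (\<integral>\<^sup>+\<omega>. ennreal (2 * p) * indicator ?R \<omega> \<partial>M)"
    by (rule nn_integral_cmult_indicator[symmetric]) (rule rare_event_sets[OF b])
  also have "\<dots> \<le> (\<integral>\<^sup>+\<omega>. (\<Sum>n. ennreal (inverse (?Z n \<omega>)) * indicator (?E n) \<omega>)
      + ennreal (p\<^sup>2) * (\<Sum>n. ennreal (?Z n \<omega>) * indicator (?E n) \<omega>) \<partial>M)"
  proof (rule nn_integral_mono)
    fix \<omega>
    show "ennreal (2 * p) * indicator ?R \<omega> \<le> (\<Sum>n. ennreal (inverse (?Z n \<omega>)) * indicator (?E n) \<omega>)
      + ennreal (p\<^sup>2) * (\<Sum>n. ennreal (?Z n \<omega>) * indicator (?E n) \<omega>)"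
    proof (cases "\<omega> \<in> ?R")
      case True
      then obtain n where n: "\<omega> \<in> ?E n" unfolding rare_event_eq by blast
      have z: "?Z n \<omega> > 0" by (rule likelihood_pos[OF fin ne])
      have "0 \<le> inverse (?Z n \<omega>) * (1 - p * ?Z n \<omega>)\<^sup>2" using z by simp
      also have "\<dots> = inverse (?Z n \<omega>) + p\<^sup>2 * ?Z n \<omega> - 2 * p"
        using z by (simp add: field_simps power2_eq_square)
      finally have "2 * p \<le> inverse (?Z n \<omega>) + p\<^sup>2 * ?Z n \<omega>" by simp
      then have "ennreal (2 * p) \<le> ennreal (inverse (?Z n \<omega>) + p\<^sup>2 * ?Z n \<omega>)" by (rule ennreal_leI)
      also have "\<dots> = ennreal (inverse (?Z n \<omega>)) + ennreal (p\<^sup>2) * ennreal (?Z n \<omega>)"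
        using z by (simp add: ennreal_plus ennreal_mult)
      finally show ?thesis
        using True by (simp add: suminf_exit_at[OF n, where g = "\<lambda>n \<omega>. ennreal (inverse (?Z n \<omega>))"]
            suminf_exit_at[OF n, where g = "\<lambda>n \<omega>. ennreal (?Z n \<omega>)"])
    qed simp
  qed
  also have "\<dots> = ?m2 + ennreal (p\<^sup>2) * (\<integral>\<^sup>+\<omega>. (\<Sum>n. ennreal (?Z n \<omega>) * indicator (?E n) \<omega>) \<partial>M)"
    unfolding second_moment_eq by (subst nn_integral_add) (simp_all add: nn_integral_cmult)
  also have "\<dots> \<le> ?m2 + ennreal (p\<^sup>2) * 1" by (intro add_left_mono mult_left_mono likelihood_mass) simp
  finally have "ennreal (p\<^sup>2) + ennreal (p\<^sup>2) \<le> ennreal (p\<^sup>2) + ?m2" by (simp add: add.commute)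
  then have "ennreal (p\<^sup>2) \<le> ?m2" by (subst (asm) ennreal_add_left_cancel_le) simp
  then show ?thesis using p by (simp add: ennreal_power)
qed

end

lemma exp_tilt_exit_mass:
  assumes Q: "exp_tilt M X \<Lambda> \<theta> Q" and b: "b > 0"
  shows "(\<integral>\<^sup>+\<omega>. (\<Sum>n. ennreal (exp (\<theta> \<bullet> S X n \<omega> - real n * real_of_ereal (\<Lambda> \<theta>)))
      * indicator (exit_at M X l u b n) \<omega>) \<partial>M) \<le> 1"
  using likelihood_mass[of "{\<theta>}" b \<Lambda> "\<lambda>_. Q" l u] assms by (simp add: likelihood_def)

end

section \<open>Asymptotics of the rare event\<close>

text \<open>The ratio is \<open>Q b / (2 * P b)\<close> with \<open>P\<close>, \<open>Q\<close> the
  negative logarithms. It is at most \<open>1\<close> by \<open>lower\<close>; \<open>upper\<close>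
  and \<open>p_ge\<close> bound it below by a quotient that tends to
  \<open>1 / (1 + \<epsilon>)\<close>.\<close>

lemma ln_ennreal_ratio_tendsto:
  fixes m p :: "real \<Rightarrow> ennreal" and R C :: real
  assumes R: "R > 0" and C: "C > 0"
    and lower: "\<forall>\<^sub>F b in at_top. (p b)\<^sup>2 \<le> m b"
    and upper: "\<forall>\<^sub>F b in at_top. m b \<le> ennreal (C * exp (- 2 * R * b))"
    and p_ge: "\<And>\<epsilon>. \<epsilon> > 0 \<Longrightarrow> \<exists>K. \<forall>\<^sub>F b in at_top. ennreal (exp (- (R * (1 + \<epsilon>) * b + K))) \<le> p b"
  shows "((\<lambda>b. ln_ennreal (m b) / (2 * ln_ennreal (p b))) \<longlongrightarrow> 1) at_top"
proof -
  define P Q where "P b = - ln (enn2real (p b))" and "Q b = - ln (enn2real (m b))" for b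
  have bounds: "\<forall>\<^sub>F b in at_top. ln_ennreal (m b) / (2 * ln_ennreal (p b)) = ereal (Q b / (2 * P b))
      \<and> Q b \<le> 2 * P b \<and> 2 * R * b - ln C \<le> Q b \<and> P b \<le> R * (1 + \<epsilon>) * b + K \<and> 0 < P b"
    if K: "\<forall>\<^sub>F b in at_top. ennreal (exp (- (R * (1 + \<epsilon>) * b + K))) \<le> p b" for \<epsilon> K
  proof -
    have "\<forall>\<^sub>F b in at_top. 2 * R * b - ln C > 0" using R by real_asymp
    with lower upper K show ?thesis
    proof eventually_elim
      case (elim b)
      have "m b < top" using elim(2) by (rule le_less_trans) simp
      then obtain m' where m': "m b = ennreal m'" "m' \<ge> 0" by (cases "m b") auto
      have "p b \<noteq> top"
      proof
        assume "p b = top"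
        then have "m b = top" using elim(1) by (simp add: power2_eq_square top_unique)
        with m' show False by simp
      qed
      then obtain p' where p': "p b = ennreal p'" "p' \<ge> 0" by (cases "p b") auto
      have p'_ge: "exp (- (R * (1 + \<epsilon>) * b + K)) \<le> p'" using elim(3) p' by (simp add: ennreal_le_iff)
      then have p0: "p' > 0" by (meson exp_gt_zero less_le_trans)
      have pm: "p'\<^sup>2 \<le> m'" using elim(1) p' m' by (simp add: ennreal_power)
      then have m0: "m' > 0" using p0 by (meson less_le_trans zero_less_power)
      have m'_le: "m' \<le> C * exp (- 2 * R * b)" using elim(2) m' C by (simp add: ennreal_le_iff)
      have PQ: "P b = - ln p'" "Q b = - ln m'" using p' m' by (simp_all add: P_def Q_def)
      have "ln (p'\<^sup>2) \<le> ln m'" using pm p0 m0 by simp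
      then have 1: "Q b \<le> 2 * P b" using p0 by (simp add: PQ ln_realpow)
      have "ln m' \<le> ln (C * exp (- 2 * R * b))" using m'_le m0 C by simp
      then have 2: "2 * R * b - ln C \<le> Q b" using C by (simp add: PQ ln_mult)
      have "ln (exp (- (R * (1 + \<epsilon>) * b + K))) \<le> ln p'" using p'_ge p0 by (simp only: ln_le_cancel_iff exp_gt_zero)
      then have 3: "P b \<le> R * (1 + \<epsilon>) * b + K" by (simp add: PQ)
      have 4: "0 < P b" using 1 2 elim(4) by linarith
      have "ln_ennreal (m b) = ereal (ln m')" "ln_ennreal (p b) = ereal (ln p')"
        using p0 m0 by (simp_all add: ln_ennreal_def p' m')
      moreover have "ereal (ln m') / (2 * ereal (ln p')) = ereal (ln m' / (2 * ln p'))"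
        using 4 by (simp add: PQ numeral_eq_ereal)
      ultimately have "ln_ennreal (m b) / (2 * ln_ennreal (p b)) = ereal (Q b / (2 * P b))"
        by (simp add: PQ)
      with 1 2 3 4 show ?case by blast
    qed
  qed
  have "((\<lambda>b. Q b / (2 * P b)) \<longlongrightarrow> 1) at_top"
  proof (rule order_tendstoI)
    fix a :: real assume "a > 1"
    obtain K where K: "\<forall>\<^sub>F b in at_top. ennreal (exp (- (R * (1 + 1) * b + K))) \<le> p b"
      using p_ge[of 1] by auto
    from bounds[OF K] show "\<forall>\<^sub>F b in at_top. Q b / (2 * P b) < a"
    proof eventually_elim
      case (elim b)
      then have "Q b / (2 * P b) \<le> 1" by (simp add: divide_le_eq)
      then show ?case using \<open>a > 1\<close> by linarith
    qed
  next
    fix a :: real assume a: "a < 1"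
    \<comment> \<open>Any \<open>\<epsilon>\<close> serves for \<open>a \<le> 0\<close>; otherwise
      half of the slack in \<open>1 + \<epsilon> < 1 / a\<close> is used.\<close>
    define \<epsilon> where "\<epsilon> = (if a \<le> 0 then 1 else (1 / a - 1) / 2)"
    have \<epsilon>: "\<epsilon> > 0" "a < 1 / (1 + \<epsilon>)" using a by (auto simp: \<epsilon>_def field_simps)
    obtain K where K: "\<forall>\<^sub>F b in at_top. ennreal (exp (- (R * (1 + \<epsilon>) * b + K))) \<le> p b"
      using p_ge[OF \<epsilon>(1)] by auto
    have "((\<lambda>b. (2 * R * b - ln C) / (2 * (R * (1 + \<epsilon>) * b + K))) \<longlongrightarrow> R * (inverse R * inverse (1 + \<epsilon>))) at_top"
      using R \<epsilon>(1) by real_asymp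
    moreover have "a < R * (inverse R * inverse (1 + \<epsilon>))" using \<epsilon>(2) R by (simp add: inverse_eq_divide)
    ultimately have "\<forall>\<^sub>F b in at_top. a < (2 * R * b - ln C) / (2 * (R * (1 + \<epsilon>) * b + K))"
      by (rule order_tendstoD(1))
    moreover have "\<forall>\<^sub>F b in at_top. 2 * R * b - ln C > 0" using R by real_asymp
    moreover note bounds[OF K]
    ultimately show "\<forall>\<^sub>F b in at_top. a < Q b / (2 * P b)"
    proof eventually_elim
      case (elim b)
      have "(2 * R * b - ln C) / (2 * (R * (1 + \<epsilon>) * b + K)) \<le> Q b / (2 * P b)"
        using elim by (intro frac_le) auto
      then show ?case using elim(1) by linarith
    qed
  qed
  then have "((\<lambda>b. ereal (Q b / (2 * P b))) \<longlongrightarrow> ereal 1) at_top" by (rule tendsto_ereal)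
  moreover obtain K where K: "\<forall>\<^sub>F b in at_top. ennreal (exp (- (R * (1 + 1) * b + K))) \<le> p b"
    using p_ge[of 1] by auto
  from bounds[OF K]
  have "\<forall>\<^sub>F b in at_top. ereal (Q b / (2 * P b)) = ln_ennreal (m b) / (2 * ln_ennreal (p b))"
    by eventually_elim simp
  ultimately show ?thesis by (simp add: one_ereal_def tendsto_cong[symmetric])
qed

section \<open>Lower bound for the probability of the rare event\<close>

locale siegmund_walk = siegmund_tilt D f f' \<Lambda> u l s t L \<kappa> + iid_walk M X
  for D :: "real set" and f f' :: "real \<Rightarrow> real" and \<Lambda> :: "real ^ 'd \<Rightarrow> ereal"
    and u l s t L \<kappa> :: real and M :: "'a measure" and X :: "nat \<Rightarrow> 'a \<Rightarrow> real ^ 'd" +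
  assumes mgf_exp: "(\<And>k. \<theta> $ k \<in> D) \<Longrightarrow> mgf \<theta> = ennreal (exp (\<Sum>k\<in>UNIV. f (\<theta> $ k)))"
begin

lemma tilt_in_D: "tilt A $ j \<in> D"
  using s_D t_D by (simp add: tilt_def)

lemma sum_f_tilt: "(\<Sum>j\<in>UNIV. f (tilt {k} $ j)) = 0"
  using \<Lambda>_tilt_singleton[of k] by (auto simp: \<Lambda>_eq zero_ereal_def split: if_splits)

lemma mgf_tilt: "mgf (tilt {k}) = 1"
  using mgf_exp[OF tilt_in_D, of "{k}"] by (simp add: sum_f_tilt)

text \<open>The logarithm of the product vanishes at \<open>\<eta> = 0\<close> and has derivative
  \<open>\<kappa> * (xbar k \<bullet> v) - c < 0\<close> there, so every small positive
  \<open>\<eta>\<close> gives a factor below \<open>1\<close>.\<close>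

lemma chernoff:
  assumes c: "\<kappa> * (xbar k \<bullet> v) < c"
  obtains \<eta> \<rho> where "\<eta> > 0" "0 \<le> \<rho>" "\<rho> < 1"
    "mgf (tilt {k} + \<eta> *\<^sub>R v) * ennreal (exp (- \<eta> * c)) = ennreal \<rho>"
proof -
  let ?g = "\<lambda>h. (\<Sum>j\<in>UNIV. f (tilt {k} $ j + h * v $ j)) - h * c"
  have "((\<lambda>h. f (tilt {k} $ j + h * v $ j)) has_real_derivative \<kappa> * xbar k $ j * v $ j) (at 0)" for j
  proof (rule DERIV_chain2[where f = f and g = "\<lambda>h. tilt {k} $ j + h * v $ j"])
    show "(f has_real_derivative \<kappa> * xbar k $ j) (at (tilt {k} $ j + 0 * v $ j))"
      using DERIV_f[OF tilt_in_D[of "{k}" j]] by (simp add: gradient)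
  qed (auto intro!: derivative_eq_intros)
  then have "((\<lambda>h. \<Sum>j\<in>UNIV. f (tilt {k} $ j + h * v $ j)) has_real_derivative
      (\<Sum>j\<in>UNIV. \<kappa> * xbar k $ j * v $ j)) (at 0)" by (intro DERIV_sum)
  moreover have "((\<lambda>h. h * c) has_real_derivative c) (at 0)" by (auto intro!: derivative_eq_intros)
  ultimately have der: "(?g has_real_derivative (\<Sum>j\<in>UNIV. \<kappa> * xbar k $ j * v $ j) - c) (at 0)"
    by (rule DERIV_diff)
  have "(\<Sum>j\<in>UNIV. \<kappa> * xbar k $ j * v $ j) - c < 0"
    using c by (simp add: inner_vec_def sum_distrib_left mult.assoc)
  from DERIV_neg_dec_right[OF der this] obtain d where d: "d > 0"
    "\<And>h. h > 0 \<Longrightarrow> h < d \<Longrightarrow> ?g h < ?g 0" by auto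
  then have "\<forall>\<^sub>F h in at_right 0. ?g h < ?g 0" by (auto simp: eventually_at_right_field)
  moreover have "\<forall>\<^sub>F h in at_right 0. \<forall>j. tilt {k} $ j + h * v $ j \<in> D"
    by (intro eventually_all_finite eventually_line_D tilt_in_D)
  moreover have "\<forall>\<^sub>F h in at_right (0::real). h > 0" by (simp add: eventually_at_right_less)
  ultimately have "\<forall>\<^sub>F h in at_right 0. h > 0 \<and> (\<forall>j. tilt {k} $ j + h * v $ j \<in> D) \<and> ?g h < ?g 0"
    by eventually_elim blast
  then obtain h where h: "h > 0" "\<And>j. tilt {k} $ j + h * v $ j \<in> D" "?g h < ?g 0"
    using eventually_happens'[OF trivial_limit_at_right_real] by blast
  have "mgf (tilt {k} + h *\<^sub>R v) = ennreal (exp (\<Sum>j\<in>UNIV. f (tilt {k} $ j + h * v $ j)))"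
    using mgf_exp[of "tilt {k} + h *\<^sub>R v"] h(2) by simp
  then have "mgf (tilt {k} + h *\<^sub>R v) * ennreal (exp (- h * c)) = ennreal (exp (?g h))"
    by (simp add: exp_diff exp_minus divide_inverse flip: ennreal_mult)
  moreover have "exp (?g h) < 1" using h(3) by (simp add: sum_f_tilt)
  ultimately show ?thesis using h(1) by (intro that[of h "exp (?g h)"]) auto
qed

lemma tail_bound:
  assumes c: "\<kappa> * (xbar k \<bullet> v) < c"
  obtains \<rho> where "0 \<le> \<rho>" "\<rho> < 1"
    "\<And>n. measure (tilted (tilt {k}) n) {\<omega> \<in> space M. real n * c \<le> v \<bullet> S X n \<omega>} \<le> \<rho> ^ n"
proof -
  obtain \<eta> \<rho> where \<rho>: "\<eta> > 0" "0 \<le> \<rho>" "\<rho> < 1"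
    "mgf (tilt {k} + \<eta> *\<^sub>R v) * ennreal (exp (- \<eta> * c)) = ennreal \<rho>" using chernoff[OF c] by blast
  have "measure (tilted (tilt {k}) n) {\<omega> \<in> space M. real n * c \<le> v \<bullet> S X n \<omega>} \<le> \<rho> ^ n" for n
    unfolding measure_def
    using tilted_tail[of \<eta> "tilt {k}" n c v] \<rho>
    by (intro enn2real_leI) (auto simp: ennreal_power)
  then show ?thesis using that \<rho> by blast
qed

text \<open>Coordinate \<open>k\<close> has positive drift \<open>\<kappa> * u\<close> under the
  tilt, so \<open>chernoff\<close> with threshold \<open>0\<close> gives an \<open>\<eta>\<close> to
  which \<open>tilted_return\<close> applies.\<close>

lemma no_return:
  obtains \<eta> where "\<eta> > 0"
    "\<And>n m c. m \<le> n \<Longrightarrow> measure (tilted (tilt {k}) n) {\<omega> \<in> space M. c \<le> - (S X m \<omega> $ k)} \<le> exp (- \<eta> * c)"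
proof -
  let ?v = "- axis k 1 :: real ^ 'd"
  have "\<kappa> * (xbar k \<bullet> ?v) < 0" using \<kappa>_pos u_pos by (simp add: inner_axis xbar_def)
  then obtain \<eta> \<rho> where \<rho>: "\<eta> > 0" "0 \<le> \<rho>" "\<rho> < 1"
    "mgf (tilt {k} + \<eta> *\<^sub>R ?v) * ennreal (exp (- \<eta> * 0)) = ennreal \<rho>" using chernoff by blast
  then have le: "mgf (tilt {k} + \<eta> *\<^sub>R ?v) \<le> 1" by (simp add: ennreal_le_1)
  have "measure (tilted (tilt {k}) n) {\<omega> \<in> space M. c \<le> - (S X m \<omega> $ k)} \<le> exp (- \<eta> * c)"
    if "m \<le> n" for n m c
    unfolding measure_def
    using tilted_return[OF less_imp_le[OF \<rho>(1)] that _ le, of c] mgf_tilt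
    by (intro enn2real_leI) (auto simp: inner_axis')
  then show ?thesis using that \<rho> by blast
qed

text \<open>The all-negative region requires every coordinate to be low, so keeping coordinate
  \<open>k\<close> up is enough to avoid it.\<close>

lemma rare_eventI:
  assumes b: "b > 0" and \<omega>: "\<omega> \<in> space M" and hit: "S X n \<omega> \<in> W (b * l) (b * u) {k}"
    and stay: "\<And>m. m \<le> n \<Longrightarrow> - (S X m \<omega> $ k) < b * l"
  shows "\<omega> \<in> rare_event M X l u b"
proof -
  have "tau X l u b {k} \<omega> \<le> enat n" using hit by (auto simp: tau_le_iff[OF b])
  then have "tau_star X l u b \<omega> \<le> enat n" unfolding tau_star_le_iff by blast
  moreover have "\<not> tau X l u b {} \<omega> \<le> enat n"
  proof
    assume "tau X l u b {} \<omega> \<le> enat n"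
    then obtain m where m: "m \<le> n" "S X m \<omega> \<in> W (b * l) (b * u) {}" by (auto simp: tau_le_iff[OF b])
    then have "S X m \<omega> $ k < - (b * l)" by (simp add: W_def)
    with stay[OF m(1)] show False by simp
  qed
  ultimately show ?thesis using \<omega> by (auto simp: rare_event_def not_le)
qed

text \<open>Cramer's lower bound. Under the tilt by \<^term>\<open>tilt {k}\<close> the drift is \<^term>\<open>\<kappa> *\<^sub>R xbar k\<close>, so at a
  time slightly beyond \<open>b / \<kappa>\<close> the walk is in the target and has not drifted back below \<open>- b l\<close>.\<close>

lemma rare_event_lower_bound:
  assumes \<epsilon>: "\<epsilon> > 0"
  shows "\<forall>\<^sub>F b in at_top. ennreal (exp (- (rbar * (1 + \<epsilon>)\<^sup>2 * b + (\<kappa> * rbar * (1 + \<epsilon>) + ln 2))))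
    \<le> emeasure M (rare_event M X l u b)"
proof -
  fix k :: 'd
  define \<beta> where "\<beta> = tilt {k}"
  \<comment> \<open>Coordinate \<open>j\<close> of the walk misses its threshold when
    \<open>v j \<bullet> S X n\<close> is too large. The speed required by \<open>c j\<close> is the
    drift \<open>\<kappa> * a j\<close> divided by \<open>1 + \<epsilon>\<close>, and
    \<open>c0\<close> exceeds the drift of \<open>\<beta> \<bullet> S X n\<close> by that factor;
    the slack makes all deviations exponentially unlikely. The time \<open>N b\<close> is just long
    enough for the reduced speed to reach the thresholds.\<close>
  define a where "a j = (if j = k then u else L)" for j
  define v where "v j = (if j = k then - axis k 1 else axis j 1 :: real ^ 'd)" for j
  define c where "c j = - \<kappa> * a j / (1 + \<epsilon>)" for j
  define c0 where "c0 = \<kappa> * rbar * (1 + \<epsilon>)"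
  define N where "N b = nat \<lceil>b * (1 + \<epsilon>) / \<kappa>\<rceil>" for b
  have a: "a j > 0" for j using u_pos l_pos L_ge by (simp add: a_def)
  have "\<kappa> * (xbar k \<bullet> v j) < c j" for j
  proof -
    have "xbar k \<bullet> v j = - a j" by (auto simp: v_def a_def xbar_def inner_axis)
    moreover have "\<kappa> * a j / (1 + \<epsilon>) < \<kappa> * a j"
      using \<epsilon> \<kappa>_pos a[of j] by (simp add: divide_less_eq)
    ultimately show ?thesis by (simp add: c_def)
  qed
  then have "\<exists>\<rho>. 0 \<le> \<rho> \<and> \<rho> < 1 \<and>
      (\<forall>n. measure (tilted \<beta> n) {\<omega> \<in> space M. real n * c j \<le> v j \<bullet> S X n \<omega>} \<le> \<rho> ^ n)" for j
    using tail_bound[of k "v j" "c j"] unfolding \<beta>_def by blast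
  then obtain \<rho> where \<rho>: "\<And>j. 0 \<le> \<rho> j" "\<And>j. \<rho> j < 1"
    "\<And>j n. measure (tilted \<beta> n) {\<omega> \<in> space M. real n * c j \<le> v j \<bullet> S X n \<omega>} \<le> \<rho> j ^ n" by metis
  have "\<kappa> * (xbar k \<bullet> \<beta>) < c0"
    using \<epsilon> \<kappa>_pos rbar_pos by (simp add: c0_def \<beta>_def rbar_eq[of k] inner_commute)
  then obtain \<rho>0 where \<rho>0: "0 \<le> \<rho>0" "\<rho>0 < 1"
    "\<And>n. measure (tilted \<beta> n) {\<omega> \<in> space M. real n * c0 \<le> \<beta> \<bullet> S X n \<omega>} \<le> \<rho>0 ^ n"
    using tail_bound[of k \<beta> c0] unfolding \<beta>_def by blast
  obtain \<eta> where \<eta>: "\<eta> > 0" "\<And>n m c. m \<le> n \<Longrightarrow>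
      measure (tilted \<beta> n) {\<omega> \<in> space M. c \<le> - (S X m \<omega> $ k)} \<le> exp (- \<eta> * c)"
    using no_return[of k] unfolding \<beta>_def by blast
  have N_ge: "b * (1 + \<epsilon>) \<le> \<kappa> * real (N b)" for b
  proof -
    have "b * (1 + \<epsilon>) / \<kappa> \<le> real (N b)" unfolding N_def by (rule real_nat_ceiling_ge)
    then show ?thesis using \<kappa>_pos by (simp add: divide_le_eq mult.commute)
  qed
  have N_le: "real (N b) \<le> b * (1 + \<epsilon>) / \<kappa> + 1" if "b > 0" for b
  proof -
    have "b * (1 + \<epsilon>) / \<kappa> > 0" using that \<epsilon> \<kappa>_pos by simp
    then show ?thesis unfolding N_def by linarith
  qed
  have N_lim: "filterlim N at_top at_top"
  proof -
    have "filterlim (\<lambda>b. b * (1 + \<epsilon>) / \<kappa>) at_top at_top" using \<epsilon> \<kappa>_pos by real_asymp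
    then have "filterlim (\<lambda>b. real (N b)) at_top at_top"
      by (rule filterlim_at_top_mono) (auto simp: N_def real_nat_ceiling_ge)
    then show ?thesis by (simp add: filterlim_sequentially_iff_filterlim_real)
  qed
  have pow: "((\<lambda>b. x ^ N b) \<longlongrightarrow> 0) at_top" if "0 \<le> x" "x < 1" for x :: real
    using filterlim_compose[OF LIMSEQ_realpow_zero[OF that] N_lim] .
  \<comment> \<open>Union bound for the bad events. The last term counts the at most
    \<open>N b + 1\<close> times at which coordinate \<open>k\<close> could be at or below
    \<open>- b * l\<close>.\<close>
  define err where "err b = (\<Sum>j\<in>UNIV. \<rho> j ^ N b) + \<rho>0 ^ N b
      + (b * (1 + \<epsilon>) / \<kappa> + 2) * exp (- (\<eta> * l) * b)" for b
  have "((\<lambda>b. \<Sum>j\<in>UNIV. \<rho> j ^ N b) \<longlongrightarrow> (\<Sum>j\<in>(UNIV :: 'd set). 0)) at_top"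
    by (intro tendsto_sum pow \<rho>)
  then have sum0: "((\<lambda>b. \<Sum>j\<in>UNIV. \<rho> j ^ N b) \<longlongrightarrow> 0) at_top" by simp
  have "(err \<longlongrightarrow> 0 + 0 + 0) at_top"
    unfolding err_def
  proof (intro tendsto_add sum0 pow)
    show "((\<lambda>b. (b * (1 + \<epsilon>) / \<kappa> + 2) * exp (- (\<eta> * l) * b)) \<longlongrightarrow> 0) at_top"
    proof -
      have "((\<lambda>b. (b * p + 2) * exp (- q * b)) \<longlongrightarrow> 0) at_top" if "p > 0" "q > 0" for p q :: real
        using that by real_asymp
      from this[of "(1 + \<epsilon>) / \<kappa>" "\<eta> * l"] show ?thesis using \<eta>(1) l_pos \<epsilon> \<kappa>_pos by simp
    qed
  qed (use \<rho> \<rho>0 in auto)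
  then have "\<forall>\<^sub>F b in at_top. err b < 1 / 2" by (intro order_tendstoD(2)) auto
  moreover have "\<forall>\<^sub>F b in at_top. (b::real) > 0" by (rule eventually_gt_at_top)
  ultimately show ?thesis
  proof eventually_elim
    case (elim b)
    note b = elim(2)
    let ?n = "N b"
    let ?Q = "tilted \<beta> ?n"
    interpret Q: prob_space ?Q
      by (rule prob_spaceI) (simp add: emeasure_tilted_space \<beta>_def mgf_tilt)
    define B where "B j = {\<omega> \<in> space M. real ?n * c j \<le> v j \<bullet> S X ?n \<omega>}" for j
    define B0 where "B0 = {\<omega> \<in> space M. real ?n * c0 \<le> \<beta> \<bullet> S X ?n \<omega>}"
    define C where "C m = {\<omega> \<in> space M. b * l \<le> - (S X m \<omega> $ k)}" for m
    have meas [measurable]: "B j \<in> sets M" "B0 \<in> sets M" "C m \<in> sets M" for j m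
      unfolding B_def B0_def C_def by measurable
    define Bad where "Bad = (\<Union>j. B j) \<union> B0 \<union> (\<Union>m\<in>{..?n}. C m)"
    have Bad [measurable]: "Bad \<in> sets M" unfolding Bad_def by measurable
    have "measure ?Q Bad \<le> measure ?Q ((\<Union>j. B j) \<union> B0) + measure ?Q (\<Union>m\<in>{..?n}. C m)"
      unfolding Bad_def by (rule measure_Un_le) (simp_all add: sets.finite_UN meas)
    also have "measure ?Q ((\<Union>j. B j) \<union> B0) \<le> measure ?Q (\<Union>j. B j) + measure ?Q B0"
      by (rule measure_Un_le) (simp_all add: sets.finite_UN meas)
    also have "measure ?Q (\<Union>j. B j) \<le> (\<Sum>j\<in>UNIV. measure ?Q (B j))"
      by (rule Q.finite_measure_subadditive_finite) (auto simp: meas)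
    also have "\<dots> \<le> (\<Sum>j\<in>UNIV. \<rho> j ^ ?n)" unfolding B_def by (intro sum_mono \<rho>(3))
    also have "measure ?Q B0 \<le> \<rho>0 ^ ?n" unfolding B0_def by (rule \<rho>0(3))
    also have "measure ?Q (\<Union>m\<in>{..?n}. C m) \<le> (\<Sum>m\<in>{..?n}. measure ?Q (C m))"
      by (rule Q.finite_measure_subadditive_finite) (auto simp: meas)
    also have "\<dots> \<le> (\<Sum>m\<in>{..?n}. exp (- \<eta> * (b * l)))"
      unfolding C_def by (intro sum_mono \<eta>(2)) auto
    also have "\<dots> = (real ?n + 1) * exp (- (\<eta> * l) * b)" by (simp add: mult_ac)
    also have "\<dots> \<le> (b * (1 + \<epsilon>) / \<kappa> + 2) * exp (- (\<eta> * l) * b)"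
      using N_le[OF b] by (intro mult_right_mono) auto
    finally have "measure ?Q Bad \<le> err b" by (simp add: err_def)
    then have "1 / 2 \<le> measure ?Q (space M - Bad)"
      using elim(1) Q.prob_compl[of Bad] by simp
    then have "ennreal (1 / 2) \<le> emeasure ?Q (space M - Bad)"
      unfolding Q.emeasure_eq_measure by (rule ennreal_leI)
    \<comment> \<open>Outside \<open>B0\<close> the density of the tilt is at most
      \<open>exp (real ?n * c0)\<close>, so half of the tilted mass costs at most this factor under
      \<open>M\<close>.\<close>
    also have "\<dots> \<le> ennreal (exp (real ?n * c0)) * emeasure M (space M - Bad)"
      by (rule emeasure_tilted_le) (auto simp: Bad_def B0_def)
    also have "\<dots> \<le> ennreal (exp (real ?n * c0)) * emeasure M (rare_event M X l u b)"
    proof (intro mult_left_mono emeasure_mono subsetI)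
      fix \<omega> assume "\<omega> \<in> space M - Bad"
      then have \<omega>: "\<omega> \<in> space M" "\<And>j. v j \<bullet> S X ?n \<omega> < real ?n * c j"
        "\<And>m. m \<le> ?n \<Longrightarrow> - (S X m \<omega> $ k) < b * l"
        by (auto simp: Bad_def B_def C_def not_le)
      have vS: "v j \<bullet> S X ?n \<omega> < - (b * a j)" for j
      proof -
        have "b * (1 + \<epsilon>) * a j \<le> \<kappa> * real ?n * a j"
          using N_ge[of b] a[of j] by (intro mult_right_mono) auto
        then have "real ?n * c j \<le> - (b * a j)"
          using \<epsilon> by (simp add: c_def field_simps)
        with \<omega>(2)[of j] show ?thesis by linarith
      qed
      have "S X ?n \<omega> \<in> W (b * l) (b * u) {k}"
      proof -
        have "S X ?n \<omega> $ k > b * u" using vS[of k] by (simp add: v_def a_def inner_axis')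
        moreover have "S X ?n \<omega> $ j < - (b * l)" if "j \<noteq> k" for j
        proof -
          have "S X ?n \<omega> $ j < - (b * L)" using vS[of j] that by (simp add: v_def a_def inner_axis')
          also have "\<dots> \<le> - (b * l)" using b L_ge by simp
          finally show ?thesis .
        qed
        ultimately show ?thesis by (simp add: W_def)
      qed
      then show "\<omega> \<in> rare_event M X l u b" using \<omega> b by (intro rare_eventI) auto
    qed (use rare_event_sets[OF b] in auto)
    also have "\<dots> = ennreal (exp (real ?n * c0) * prob (rare_event M X l u b))"
      by (simp add: emeasure_eq_measure ennreal_mult)
    finally have half: "1 / 2 \<le> exp (real ?n * c0) * prob (rare_event M X l u b)"
      by (subst (asm) ennreal_le_iff) auto
    \<comment> \<open>One factor \<open>1 + \<epsilon>\<close> comes from the time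
      \<open>N b\<close> and one from \<open>c0\<close>; rounding \<open>N b\<close> up costs the
      additive constant.\<close>
    have "real ?n * c0 \<le> (b * (1 + \<epsilon>) / \<kappa> + 1) * c0"
      using N_le[OF b] \<kappa>_pos rbar_pos \<epsilon> by (intro mult_right_mono) (auto simp: c0_def)
    also have "\<dots> = rbar * (1 + \<epsilon>)\<^sup>2 * b + \<kappa> * rbar * (1 + \<epsilon>)"
      using \<kappa>_pos by (simp add: c0_def field_simps power2_eq_square)
    finally have n_le: "real ?n * c0 \<le> rbar * (1 + \<epsilon>)\<^sup>2 * b + \<kappa> * rbar * (1 + \<epsilon>)" .
    have "exp (- (rbar * (1 + \<epsilon>)\<^sup>2 * b + (\<kappa> * rbar * (1 + \<epsilon>) + ln 2))) \<le> exp (- (real ?n * c0) - ln 2)"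
      using n_le by simp
    also have "\<dots> = (1 / 2) * exp (- (real ?n * c0))" by (simp add: exp_diff)
    also have "\<dots> \<le> exp (real ?n * c0) * prob (rare_event M X l u b) * exp (- (real ?n * c0))"
      using half by (intro mult_right_mono) auto
    also have "\<dots> = prob (rare_event M X l u b)" by (simp add: exp_minus)
    finally show ?case unfolding emeasure_eq_measure by (rule ennreal_leI)
  qed
qed

end

section \<open>Upper bound for the second moment, and asymptotic efficiency\<close>

context siegmund_walk
begin

text \<open>The set \<open>A\<close> through which the walk exits depends on the path, so the
  pointwise bound sums the weights over all sets. Each weight integrates to at most \<open>1\<close>
  over the rare event by \<open>exp_tilt_exit_mass\<close>, which explains the factor
  \<open>CARD('d set)\<close>; \<open>card \<Theta>\<close> comes from keeping one term of the
  mixture.\<close>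

lemma second_moment_upper:
  assumes d: "real CARD('d) \<ge> 2 + 2 * l / u" and b: "b > 0"
    and P: "\<And>\<theta>. \<theta> \<in> edom \<Lambda> \<Longrightarrow> exp_tilt M X \<Lambda> \<theta> (P \<theta>)"
    and \<Theta>: "\<Theta> = range (\<lambda>k. tilt {k})"
  shows "(\<integral>\<^sup>+\<omega>. ennreal ((estimator M X \<Lambda> l u \<Theta> b \<omega>)\<^sup>2) \<partial>mixture M P \<Theta>)
    \<le> ennreal (card \<Theta> * CARD('d set) * exp (- 2 * rbar * b))"
proof -
  let ?E = "exit_at M X l u b" and ?Z = "likelihood \<Lambda> \<Theta>" and ?c = "card \<Theta> * exp (- 2 * rbar * b)"
  let ?w = "\<lambda>A n \<omega>. exp (tilt A \<bullet> S X n \<omega> - real n * real_of_ereal (\<Lambda> (tilt A)))"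
  have fin: "finite \<Theta>" and ne: "\<Theta> \<noteq> {}" by (auto simp: \<Theta>)
  have P': "\<theta> \<in> \<Theta> \<Longrightarrow> exp_tilt M X \<Lambda> \<theta> (P \<theta>)" for \<theta> using P tilt_edom by (auto simp: \<Theta>)
  have [measurable]: "?E n \<in> sets M" for n by (rule exit_at_sets[OF b])
  have pw: "inverse (?Z n \<omega>) \<le> ?c * (\<Sum>A\<in>UNIV. ?w A n \<omega>)" if \<omega>: "\<omega> \<in> ?E n" for n \<omega>
  proof -
    obtain A where A: "A \<noteq> {}" "S X n \<omega> \<in> W (b * l) (b * u) A" using exit_atD[OF b \<omega>] .
    then obtain x where x: "x \<in> W l u A" "S X n \<omega> = b *\<^sub>R x" using mem_scaled_W[OF b] by blast
    obtain k where "2 * rbar \<le> tilt {k} \<bullet> x + tilt A \<bullet> x" using two_rbar_le[OF A(1) x(1) d] .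
    then have "b * (2 * rbar) \<le> b * (tilt {k} \<bullet> x + tilt A \<bullet> x)" using b by simp
    then have k: "2 * rbar * b \<le> tilt {k} \<bullet> S X n \<omega> + tilt A \<bullet> S X n \<omega>"
      by (simp add: x(2) algebra_simps)
    have N: "real (card \<Theta>) > 0" using fin ne by (simp add: card_gt_0_iff)
    have "exp (tilt {k} \<bullet> S X n \<omega> - real n * real_of_ereal (\<Lambda> (tilt {k})))
        \<le> (\<Sum>\<theta>\<in>\<Theta>. exp (\<theta> \<bullet> S X n \<omega> - real n * real_of_ereal (\<Lambda> \<theta>)))"
      by (rule member_le_sum) (auto simp: \<Theta>)
    then have "exp (tilt {k} \<bullet> S X n \<omega>) / card \<Theta> \<le> ?Z n \<omega>"
      unfolding likelihood_def \<Lambda>_tilt_singleton using N by (simp add: divide_right_mono)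
    then have "inverse (?Z n \<omega>) \<le> inverse (exp (tilt {k} \<bullet> S X n \<omega>) / card \<Theta>)"
      using N by (intro le_imp_inverse_le) auto
    also have "\<dots> = card \<Theta> * exp (- (tilt {k} \<bullet> S X n \<omega>))" by (simp add: exp_minus divide_inverse)
    also have "\<dots> \<le> card \<Theta> * exp (- 2 * rbar * b + tilt A \<bullet> S X n \<omega>)"
      using k by (intro mult_left_mono) auto
    also have "\<dots> = ?c * exp (tilt A \<bullet> S X n \<omega>)" by (simp only: exp_add mult.assoc)
    \<comment> \<open>Because \<open>\<Lambda> (tilt A) \<le> 0\<close>, the normalisation can only
      enlarge the exponential.\<close>
    also have "\<dots> \<le> ?c * ?w A n \<omega>"
    proof -
      have "real_of_ereal (\<Lambda> (tilt A)) \<le> 0" using \<Lambda>_tilt_le[OF A(1)] by (simp add: \<Lambda>_tilt zero_ereal_def)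
      then have "real n * real_of_ereal (\<Lambda> (tilt A)) \<le> 0" by (simp add: mult_nonneg_nonpos)
      then show ?thesis by (intro mult_left_mono) auto
    qed
    also have "\<dots> \<le> ?c * (\<Sum>A\<in>UNIV. ?w A n \<omega>)"
      by (intro mult_left_mono member_le_sum) auto
    finally show ?thesis .
  qed
  have "(\<integral>\<^sup>+\<omega>. ennreal ((estimator M X \<Lambda> l u \<Theta> b \<omega>)\<^sup>2) \<partial>mixture M P \<Theta>)
      = (\<integral>\<^sup>+\<omega>. (\<Sum>n. ennreal (inverse (?Z n \<omega>)) * indicator (?E n) \<omega>) \<partial>M)"
    by (rule second_moment_eq[OF fin ne b P'])
  also have "\<dots> \<le> (\<integral>\<^sup>+\<omega>. ennreal ?c * (\<Sum>A\<in>UNIV. \<Sum>n. ennreal (?w A n \<omega>) * indicator (?E n) \<omega>) \<partial>M)"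
  proof (rule nn_integral_mono)
    fix \<omega>
    show "(\<Sum>n. ennreal (inverse (?Z n \<omega>)) * indicator (?E n) \<omega>)
        \<le> ennreal ?c * (\<Sum>A\<in>UNIV. \<Sum>n. ennreal (?w A n \<omega>) * indicator (?E n) \<omega>)"
    proof (cases "\<omega> \<in> rare_event M X l u b")
      case True
      then obtain n where n: "\<omega> \<in> ?E n" unfolding rare_event_eq by blast
      have "ennreal (inverse (?Z n \<omega>)) \<le> ennreal (?c * (\<Sum>A\<in>UNIV. ?w A n \<omega>))"
        by (rule ennreal_leI[OF pw[OF n]])
      also have "\<dots> = ennreal ?c * (\<Sum>A\<in>UNIV. ennreal (?w A n \<omega>))"
        by (subst ennreal_mult) (auto simp: sum_nonneg)
      finally show ?thesis
        unfolding suminf_exit_at[OF n, where g = "\<lambda>n \<omega>. ennreal (inverse (?Z n \<omega>))"]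
          suminf_exit_at[OF n, where g = "\<lambda>n \<omega>. ennreal (?w A n \<omega>)" for A] .
    next
      case False
      show ?thesis
        unfolding suminf_not_rare[OF False, where g = "\<lambda>n \<omega>. ennreal (inverse (?Z n \<omega>))"] by simp
    qed
  qed
  also have "\<dots> = ennreal ?c * (\<Sum>A\<in>UNIV. \<integral>\<^sup>+\<omega>. (\<Sum>n. ennreal (?w A n \<omega>) * indicator (?E n) \<omega>) \<partial>M)"
    by (subst nn_integral_cmult) (simp_all add: nn_integral_sum)
  also have "\<dots> \<le> ennreal ?c * (\<Sum>A\<in>(UNIV :: 'd set set). 1)"
    by (intro mult_left_mono sum_mono exp_tilt_exit_mass[OF P[OF tilt_edom] b]) simp
  also have "\<dots> = ennreal (card \<Theta> * CARD('d set) * exp (- 2 * rbar * b))"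
    by (simp add: ennreal_of_nat_eq_real_of_nat mult_ac flip: ennreal_mult)
  finally show ?thesis .
qed

lemma asymp_efficient_singletons:
  assumes d: "real CARD('d) \<ge> 2 + 2 * l / u"
    and P: "\<And>\<theta>. \<theta> \<in> edom \<Lambda> \<Longrightarrow> exp_tilt M X \<Lambda> \<theta> (P \<theta>)"
  shows "asymp_efficient M X \<Lambda> l u P {beta \<Lambda> l u {k} | k. True}"
proof -
  define \<Theta> where "\<Theta> = range (\<lambda>k. tilt {k})"
  have \<Theta>: "{beta \<Lambda> l u {k} | k. True} = \<Theta>" by (auto simp: beta_singleton \<Theta>_def)
  have fin: "finite \<Theta>" and ne: "\<Theta> \<noteq> {}" by (auto simp: \<Theta>_def)
  have P': "\<theta> \<in> \<Theta> \<Longrightarrow> exp_tilt M X \<Lambda> \<theta> (P \<theta>)" for \<theta> using P tilt_edom by (auto simp: \<Theta>_def)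
  have pos: "\<forall>\<^sub>F b in at_top. (b::real) > 0" by (rule eventually_gt_at_top)
  show ?thesis
    unfolding asymp_efficient_def \<Theta>
  proof (rule ln_ennreal_ratio_tendsto[OF rbar_pos])
    show "0 < real (card \<Theta> * CARD('d set))" using fin ne by (simp add: card_gt_0_iff)
    show "\<forall>\<^sub>F b in at_top. (emeasure M (rare_event M X l u b))\<^sup>2
        \<le> (\<integral>\<^sup>+\<omega>. ennreal ((estimator M X \<Lambda> l u \<Theta> b \<omega>)\<^sup>2) \<partial>mixture M P \<Theta>)"
      using pos by eventually_elim (rule second_moment_ge[OF fin ne _ P'])
    show "\<forall>\<^sub>F b in at_top. (\<integral>\<^sup>+\<omega>. ennreal ((estimator M X \<Lambda> l u \<Theta> b \<omega>)\<^sup>2) \<partial>mixture M P \<Theta>)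
        \<le> ennreal (real (card \<Theta> * CARD('d set)) * exp (- 2 * rbar * b))"
      using pos
    proof eventually_elim
      case (elim b)
      show ?case using second_moment_upper[OF d elim P \<Theta>_def] by simp
    qed
  next
    fix \<epsilon> :: real assume \<epsilon>: "\<epsilon> > 0"
    \<comment> \<open>Chosen so that \<open>(1 + \<delta>)\<^sup>2 \<le> 1 + 3 * \<delta> \<le> 1 +
      \<epsilon>\<close>.\<close>
    define \<delta> where "\<delta> = min 1 (\<epsilon> / 3)"
    have \<delta>: "\<delta> > 0" "\<delta> \<le> 1" "3 * \<delta> \<le> \<epsilon>" using \<epsilon> by (auto simp: \<delta>_def)
    have "\<delta> * \<delta> \<le> 1 * \<delta>" using \<delta> by (intro mult_right_mono) auto
    then have sq: "(1 + \<delta>)\<^sup>2 \<le> 1 + \<epsilon>" using \<delta>(3) by (simp add: power2_eq_square algebra_simps)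
    let ?K = "\<kappa> * rbar * (1 + \<delta>) + ln 2"
    have "\<forall>\<^sub>F b in at_top. ennreal (exp (- (rbar * (1 + \<epsilon>) * b + ?K))) \<le> emeasure M (rare_event M X l u b)"
      using rare_event_lower_bound[OF \<delta>(1)] pos
    proof eventually_elim
      case (elim b)
      have "rbar * (1 + \<delta>)\<^sup>2 * b \<le> rbar * (1 + \<epsilon>) * b"
        using sq rbar_pos elim(2) by (intro mult_right_mono mult_left_mono) auto
      then have "ennreal (exp (- (rbar * (1 + \<epsilon>) * b + ?K))) \<le> ennreal (exp (- (rbar * (1 + \<delta>)\<^sup>2 * b + ?K)))"
        by (intro ennreal_leI) simp
      with elim(1) show ?case by (rule order_trans[rotated])
    qed
    then show "\<exists>K. \<forall>\<^sub>F b in at_top. ennreal (exp (- (rbar * (1 + \<epsilon>) * b + K)))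
        \<le> emeasure M (rare_event M X l u b)" by blast
  qed
qed

end

section \<open>Reduction of the hypotheses to the one-dimensional profile\<close>

lemma (in prob_space) exp_product:
  fixes Z :: "'a \<Rightarrow> real ^ 'd"
  assumes indep: "indep_vars (\<lambda>_. borel) (\<lambda>k \<omega>. Z \<omega> $ k) UNIV"
    and same: "\<And>j k. distr M borel (\<lambda>\<omega>. Z \<omega> $ j) = distr M borel (\<lambda>\<omega>. Z \<omega> $ k)"
  shows "(\<integral>\<^sup>+\<omega>. ennreal (exp (\<theta> \<bullet> Z \<omega>)) \<partial>M)
    = (\<Prod>k\<in>UNIV. \<integral>\<^sup>+\<omega>. ennreal (exp (\<theta> $ k * Z \<omega> $ i)) \<partial>M)"
proof -
  have Z: "(\<lambda>\<omega>. Z \<omega> $ k) \<in> borel_measurable M" for k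
    using indep by (auto simp: indep_vars_def)
  have distr: "(\<integral>\<^sup>+\<omega>. ennreal (exp (t * Z \<omega> $ k)) \<partial>M)
      = (\<integral>\<^sup>+x. ennreal (exp (t * x)) \<partial>distr M borel (\<lambda>\<omega>. Z \<omega> $ k))" for t k
    by (rule nn_integral_distr[symmetric]) (use Z in auto)
  have "(\<integral>\<^sup>+\<omega>. ennreal (exp (\<theta> \<bullet> Z \<omega>)) \<partial>M) = (\<integral>\<^sup>+\<omega>. (\<Prod>k\<in>UNIV. ennreal (exp (\<theta> $ k * Z \<omega> $ k))) \<partial>M)"
    by (simp add: inner_vec_def exp_sum prod_ennreal)
  also have "\<dots> = (\<Prod>k\<in>UNIV. \<integral>\<^sup>+\<omega>. ennreal (exp (\<theta> $ k * Z \<omega> $ k)) \<partial>M)"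
  proof (rule indep_vars_nn_integral)
    show "indep_vars (\<lambda>_. borel) (\<lambda>k \<omega>. ennreal (exp (\<theta> $ k * Z \<omega> $ k))) UNIV"
      by (rule indep_vars_compose2[OF indep]) measurable
  qed auto
  also have "\<dots> = (\<Prod>k\<in>UNIV. \<integral>\<^sup>+\<omega>. ennreal (exp (\<theta> $ k * Z \<omega> $ i)) \<partial>M)"
    unfolding distr using same by (intro prod.cong refl) metis
  finally show ?thesis .
qed

text \<open>Along the diagonal the supremum defining the conjugate is at least \<open>t\<close>
  times the positive sum of the entries of \<open>y\<close>, for every \<open>t \<ge> 0\<close>.
  This makes the cone assumption exclude coordinates that are almost surely nonpositive.\<close>

lemma edom_conjugate_not_positive:
  fixes \<Lambda> :: "real ^ 'd \<Rightarrow> ereal"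
  assumes le: "\<And>t. t \<ge> 0 \<Longrightarrow> \<Lambda> (\<chi> k. t) \<le> 0" and y: "\<And>k. y $ k > 0"
  shows "y \<notin> edom (conjugate \<Lambda>)"
proof
  assume "y \<in> edom (conjugate \<Lambda>)"
  then have fin: "conjugate \<Lambda> y < \<infinity>" by (simp add: edom_def)
  define s where "s = (\<Sum>k\<in>UNIV. y $ k)"
  have s: "s > 0" unfolding s_def by (intro sum_pos y) auto
  have ge: "ereal (t * s) \<le> conjugate \<Lambda> y" if "t \<ge> 0" for t
  proof -
    have "(\<chi> k. t) \<bullet> y = t * s" by (simp add: inner_vec_def s_def sum_distrib_left)
    then have "ereal (t * s) \<le> ereal ((\<chi> k. t) \<bullet> y) - \<Lambda> (\<chi> k. t)"
      using le[OF that] by (cases "\<Lambda> (\<chi> k. t)") auto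
    also have "\<dots> \<le> conjugate \<Lambda> y" unfolding conjugate_def by (rule SUP_upper) simp
    finally show ?thesis .
  qed
  obtain a where a: "conjugate \<Lambda> y = ereal a" using fin ge[of 0] by (cases "conjugate \<Lambda> y") auto
  have "(\<bar>a\<bar> + 1) / s * s \<le> a" using ge[of "(\<bar>a\<bar> + 1) / s"] s a by simp
  then show False using s by simp
qed

theorem theorem4p4:
  fixes M :: "'w measure" and X :: "nat \<Rightarrow> 'w \<Rightarrow> real ^ 'd"
    and l u :: real and \<Lambda> :: "real ^ 'd \<Rightarrow> ereal"
  assumes "prob_space M"
    and "prob_space.indep_vars M (\<lambda>_. borel) X {1..}"
    and "\<And>i. i \<ge> 1 \<Longrightarrow> distr M borel (X i) = distr M borel (X 1)"
    and "\<And>k. integrable M (\<lambda>\<omega>. X 1 \<omega> $ k)"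
    and "\<And>k. (\<integral>\<omega>. X 1 \<omega> $ k \<partial>M) < 0"
    and "\<Lambda> = log_mgf M (X 1)"
    and "l > 0" and "u > 0"
    and "open (edom \<Lambda>)"
    and "\<And>A. A \<noteq> {} \<Longrightarrow> interior (pos_cone (edom (conjugate \<Lambda>))) \<inter> W l u A \<noteq> {}"
    and "prob_space.indep_vars M (\<lambda>_. borel) (\<lambda>k \<omega>. X 1 \<omega> $ k) UNIV"
    and "\<And>j k. distr M borel (\<lambda>\<omega>. X 1 \<omega> $ j) = distr M borel (\<lambda>\<omega>. X 1 \<omega> $ k)"
  shows "(real CARD('d) \<ge> 1 + l / u \<longrightarrow> r_star \<Lambda> l u = (MIN k. r \<Lambda> l u {k}))
    \<and> (real CARD('d) \<ge> 2 + 2 * l / u \<longrightarrow>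
        (\<forall>P. (\<forall>\<theta>\<in>edom \<Lambda>. exp_tilt M X \<Lambda> \<theta> (P \<theta>)) \<longrightarrow>
          asymp_efficient M X \<Lambda> l u P {beta \<Lambda> l u {k} | k. True}))"
proof (cases "real CARD('d) \<ge> 1 + l / u")
  case False
  \<comment> \<open>Both claims are vacuous if the weaker dimension bound fails.\<close>
  moreover have "1 + l / u \<le> 2 + 2 * l / u" using assms(7,8) by (simp add: field_simps)
  ultimately show ?thesis by linarith
next
  case True
  interpret prob_space M by fact
  fix i :: 'd
  define Y where "Y \<omega> = X 1 \<omega> $ i" for \<omega>
  define \<phi> where "\<phi> t = (\<integral>\<^sup>+\<omega>. ennreal (exp (t * Y \<omega>)) \<partial>M)" for t
  let ?D = "mgf_dom M Y" and ?f = "cgf M Y"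
  have [measurable]: "Y \<in> borel_measurable M" using assms(4)[of i] by (simp add: Y_def[abs_def])
  have prod: "(\<integral>\<^sup>+\<omega>. ennreal (exp (\<theta> \<bullet> X 1 \<omega>)) \<partial>M) = (\<Prod>k\<in>UNIV. \<phi> (\<theta> $ k))" for \<theta>
    unfolding \<phi>_def Y_def by (rule exp_product[OF assms(11,12)])
  have \<Lambda>_prod: "\<Lambda> \<theta> = ln_ennreal (\<Prod>k\<in>UNIV. \<phi> (\<theta> $ k))" for \<theta>
    by (simp only: assms(6) log_mgf_def prod)
  \<comment> \<open>Positivity of every factor prevents a product of \<open>0\<close> and infinity,
    so a single infinite factor makes \<open>\<Lambda>\<close> infinite.\<close>
  have \<phi>_pos: "\<phi> t \<noteq> 0" for t
  proof
    assume "\<phi> t = 0"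
    then have "AE \<omega> in M. ennreal (exp (t * Y \<omega>)) = 0"
      unfolding \<phi>_def by (subst (asm) nn_integral_0_iff_AE) auto
    then show False by simp
  qed
  have D_iff: "t \<in> ?D \<longleftrightarrow> \<phi> t < \<infinity>" for t by (simp add: mgf_dom_def \<phi>_def integrable_iff_bounded)
  have \<Lambda>_infty: "\<Lambda> \<theta> = \<infinity>" if "\<theta> $ k \<notin> ?D" for \<theta> k
  proof -
    have "(\<Prod>k\<in>UNIV. \<phi> (\<theta> $ k)) = top"
      using that \<phi>_pos by (auto simp: ennreal_prod_eq_top D_iff simp flip: less_top)
    then show ?thesis by (simp add: \<Lambda>_prod ln_ennreal_def)
  qed
  \<comment> \<open>The one-dimensional domain is the preimage of \<open>edom \<Lambda>\<close>
    under the continuous diagonal map.\<close>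
  have open_D: "open ?D"
  proof -
    have "(\<chi> k. t) \<in> edom \<Lambda> \<longleftrightarrow> t \<in> ?D" for t
    proof
      assume "t \<in> ?D"
      then have "(\<Prod>k\<in>(UNIV :: 'd set). \<phi> t) < top" by (simp add: D_iff power_less_top_ennreal)
      then show "(\<chi> k. t) \<in> edom \<Lambda>" by (simp add: edom_def \<Lambda>_prod ln_ennreal_def)
    qed (use \<Lambda>_infty[of "\<chi> k. t"] in \<open>auto simp: edom_def\<close>)
    then have "?D = (\<lambda>t. \<chi> k. t) -` edom \<Lambda>" by auto
    moreover have "continuous_on UNIV (\<lambda>t::real. (\<chi> k. t) :: real ^ 'd)" by (intro continuous_intros)
    ultimately show ?thesis using open_vimage[OF assms(9)] by simp
  qed
  \<comment> \<open>Otherwise \<open>\<Lambda> \<le> 0\<close> on the nonnegative diagonal, while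
    the cone assumption for \<open>A = UNIV\<close> provides a point with positive entries and
    finite conjugate.\<close>
  have not_le: "\<not> (AE \<omega> in M. Y \<omega> \<le> 0)"
  proof
    assume AE: "AE \<omega> in M. Y \<omega> \<le> 0"
    have "\<phi> t \<le> 1" if "t \<ge> 0" for t
    proof -
      have "\<phi> t \<le> (\<integral>\<^sup>+\<omega>. 1 \<partial>M)"
        unfolding \<phi>_def
        by (rule nn_integral_mono_AE, use AE in eventually_elim) (use that in \<open>simp add: mult_nonneg_nonpos ennreal_le_1\<close>)
      then show ?thesis by (simp add: emeasure_space_1)
    qed
    then have "(\<Prod>k\<in>(UNIV :: 'd set). \<phi> t) \<le> 1" if "t \<ge> 0" for t
      using that by (simp add: power_le_one)
    moreover have "ln_ennreal x \<le> 0" if "x \<le> 1" for x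
    proof -
      have "x < \<infinity>" using that by (rule le_less_trans) simp
      then obtain y where y: "x = ennreal y" "y \<ge> 0" by (cases x) auto
      then have "y \<le> 1" using that by simp
      then show ?thesis using y by (auto simp: ln_ennreal_def zero_ereal_def)
    qed
    ultimately have le: "\<Lambda> (\<chi> k. t) \<le> 0" if "t \<ge> 0" for t
      using that by (simp add: \<Lambda>_prod)
    obtain x where x: "x \<in> pos_cone (edom (conjugate \<Lambda>))" "x \<in> W l u UNIV"
      using assms(10)[of UNIV] interior_subset by blast
    then obtain c y where y: "x = c *\<^sub>R y" "c > 0" "y \<in> edom (conjugate \<Lambda>)" by (auto simp: pos_cone_def)
    have "y $ k > 0" for k
    proof -
      have "c * y $ k > 0" using x(2) y(1) assms(8) by (auto simp: W_def intro: less_trans)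
      then show ?thesis using y(2) by (simp add: zero_less_mult_iff)
    qed
    then have "y \<notin> edom (conjugate \<Lambda>)" by (intro edom_conjugate_not_positive le)
    with y(3) show False by blast
  qed
  interpret Y: negative_mean_rv M Y
    by unfold_locales (use assms(4)[of i] assms(5)[of i] not_le open_D in \<open>auto simp: Y_def[abs_def]\<close>)
  have prod_\<phi>: "(\<Prod>k\<in>UNIV. \<phi> (\<theta> $ k)) = ennreal (exp (\<Sum>k\<in>UNIV. ?f (\<theta> $ k)))"
    if "\<And>k. \<theta> $ k \<in> ?D" for \<theta> :: "real ^ 'd"
    unfolding \<phi>_def Y.mgf_nn_integral[OF that] by (simp add: exp_sum prod_ennreal)
  have prod_exp: "(\<integral>\<^sup>+\<omega>. ennreal (exp (\<theta> \<bullet> X 1 \<omega>)) \<partial>M) = ennreal (exp (\<Sum>k\<in>UNIV. ?f (\<theta> $ k)))"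
    if "\<And>k. \<theta> $ k \<in> ?D" for \<theta>
    unfolding prod using prod_\<phi>[OF that] .
  have \<Lambda>_eq: "\<Lambda> \<theta> = (if \<forall>k. \<theta> $ k \<in> ?D then ereal (\<Sum>k\<in>UNIV. ?f (\<theta> $ k)) else \<infinity>)" for \<theta>
  proof (cases "\<forall>k. \<theta> $ k \<in> ?D")
    case True
    then show ?thesis by (simp add: \<Lambda>_prod prod_\<phi> ln_ennreal_def)
  qed (use \<Lambda>_infty in auto)
  \<comment> \<open>The dimension bound forces at least two coordinates, hence a positive weight
    \<open>c\<close> in \<open>optimal_pair\<close>.\<close>
  have "l / u > 0" using assms(7,8) by simp
  then have "real CARD('d) > 1" using True by linarith
  then have card: "real (CARD('d) - 1) > 0" by simp
  obtain s t L \<kappa> where opt: "s > 0" "t \<ge> 0" "s \<in> ?D" "- t \<in> ?D" "L \<ge> l" "L = l \<or> t = 0" "\<kappa> > 0"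
    "?f s + real (CARD('d) - 1) * ?f (- t) = 0" "cgf' M Y s = \<kappa> * u" "cgf' M Y (- t) = - \<kappa> * L"
    "real (CARD('d) - 1) * t \<le> s"
    using Y.cgf.optimal_pair[OF assms(8,7) card] .
  interpret siegmund_tilt ?D ?f "cgf' M Y" \<Lambda> u l s t L \<kappa>
    by unfold_locales (fact opt \<Lambda>_eq assms(7,8) True)+
  interpret iid_walk M X by unfold_locales (fact assms(2,3))+
  interpret siegmund_walk ?D ?f "cgf' M Y" \<Lambda> u l s t L \<kappa> M X
    by unfold_locales (simp only: mgf_def prod_exp)
  show ?thesis
  proof (intro conjI impI allI)
    show "r_star \<Lambda> l u = (MIN k. r \<Lambda> l u {k})" by (rule r_star_eq)
    fix P assume "real CARD('d) \<ge> 2 + 2 * l / u" "\<forall>\<theta>\<in>edom \<Lambda>. exp_tilt M X \<Lambda> \<theta> (P \<theta>)"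
    then show "asymp_efficient M X \<Lambda> l u P {beta \<Lambda> l u {k} | k. True}"
      by (intro asymp_efficient_singletons) auto
  qed
qed

end
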